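(* Let $\Phi$ be an irreducible affine reflection system whose underlying finite root system $\mathring{\Phi}$ is reduced. A subset $\Psi\subseteq\Phi$ is a maximal closed subroot system with proper closed gradient if and only if $$\Psi=\{\alpha\oplus\Lambda_s:\alpha\in\mathring{\Phi}'\cap\mathring{\Phi}_s\}\cup\{\alpha\oplus\Lambda_\ell:\alpha\in\mathring{\Phi}'\cap\mathring{\Phi}_\ell\},$$ where (1) $\mathring{\Phi}'$ is any maximal closed subroot system of $\mathring{\Phi}$, if $\Lambda_\ell=\Lambda_s$; (2) $\mathring{\Phi}'$ is any maximal closed subroot system of $\mathring{\Phi}$ such that $\mathring{\Phi}'\cap\mathring{\Phi}_s\neq\emptyset$, if $\Lambda_\ell\subsetneq\Lambda_s$.
   Context: Finite root systems: $V$ is a finite-dimensional real Euclidean space with inner product $(\cdot,\cdot)$. A finite root system $\mathring{\Phi}\subset V$ is a finite spanning set with $0\notin\mathring{\Phi}$, $s_\alpha(\mathring{\Phi})=\mathring{\Phi}$ and $(\beta,\alpha^\vee)\in\mathbb{Z}$ for all $\alpha,\beta\in\mathring{\Phi}$, where $\alpha^\vee=2\alpha/(\alpha,\alpha)$ and $s_\alpha(v)=v-(v,\alpha^\vee)\alpha$; it is reduced if $\mathbb{R}\alpha\cap\mathring{\Phi}=\{\pm\alpha\}$ for all $\alpha\in\mathring{\Phi}$. For irreducible reduced $\mathring{\Phi}$, $\mathring{\Phi}_s$ and $\mathring{\Phi}_\ell$ are the sets of short and long roots; if only one root length occurs, every root is long. Type conventions: $B_n$ for $n\ge2$, $C_n$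 for $n\ge3$. Extension datum (for reduced $\mathring{\Phi}$): a family $(\Lambda_\alpha)_{\alpha\in\mathring{\Phi}\cup\{0\}}$ of subsets of a finite-dimensional real vector space $Y$ such that (1) $\Lambda_\beta-(\beta,\alpha^\vee)\Lambda_\alpha\subseteq\Lambda_{s_\alpha(\beta)}$ for all $\alpha,\beta\in\mathring{\Phi}$; (2) $0\in\Lambda_\alpha$ for all $\alpha\in\mathring{\Phi}\cup\{0\}$; (3) $Y$ is the real span of $\bigcup_\alpha\Lambda_\alpha$. For $\mathring{\Phi}$ irreducible, $\Lambda_\alpha$ ($\alpha\in\mathring{\Phi}$) depends only on the length of $\alpha$; the common values on short and long roots are denoted $\Lambda_s$ and $\Lambda_\ell$, with the convention $\Lambda_s=\Lambda_\ell$ in the simply-laced case. Standing assumptions: $\mathring{\Phi}$ has rank at least $2$, and if $\mathring{\Phi}$ is of type $B_2$ then $\Lambda_\ell$ is a subgroup of $Y$. Affine reflection system: up to isomorphism, every affine reflection system is $\Phi=\bigcup_{\alpha\in\mathring{\Phi}\cup\{0\}}\alpha\oplus\Lambda_\alpha\subset X=V\oplus Y$ with form $(v_1\oplus y_1,v_2\oplus y_2)_X=(v_1,v_2)$, for a finite root system $\mathring{\Phi}$ and an extension datum; it is irreducible iff $\mathring{\Phi}$ is. Here $\alpha\oplus S=\{\alpha\oplus y:y\in S\}$ for a subset $S\subseteq Y$, and displayed sets of such expressions denote their unions. The real roots are $\Phi^{\mathrm{re}}=\bigcup_{\alpha\in\mathring{\Phi}}\alpha\oplus\Lambda_\alpha$,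 and $s_{\alpha\oplus y}(\beta\oplus z)=s_\alpha(\beta)\oplus(z-(\beta,\alpha^\vee)y)$. Subroot systems: a proper non-empty subset $\Psi\subsetneq\Phi^{\mathrm{re}}$ is a subroot system if $s_a(b)\in\Psi$ for all $a,b\in\Psi$; it is closed if $a,b\in\Psi$ and $a+b\in\Phi^{\mathrm{re}}$ imply $a+b\in\Psi$; it is a maximal closed subroot system if it is a closed subroot system and there is no closed subroot system $\Psi'$ with $\Psi\subsetneq\Psi'\subsetneq\Phi^{\mathrm{re}}$. The same definitions apply to subsets of $\mathring{\Phi}$ (the case $Y=0$, with $\mathring{\Phi}$ in place of $\Phi^{\mathrm{re}}$). The gradient is $\mathrm{Gr}(\Psi)=\{\alpha\in\mathring{\Phi}:\exists y\in\Lambda_\alpha,\ \alpha\oplus y\in\Psi\}$. "Proper closed gradient" means $\mathrm{Gr}(\Psi)\subsetneq\mathring{\Phi}$ and $\mathrm{Gr}(\Psi)$ is closed in $\mathring{\Phi}$. *)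

theory Defs
  imports "HOL-Analysis.Analysis"
begin

section \<open>Finite root systems\<close>

definition coroot :: "'v::real_inner \<Rightarrow> 'v" where
  "coroot \<alpha> = (2 / (\<alpha> \<bullet> \<alpha>)) *\<^sub>R \<alpha>"

definition root_refl :: "'v::real_inner \<Rightarrow> 'v \<Rightarrow> 'v" where
  "root_refl \<alpha> v = v - (v \<bullet> coroot \<alpha>) *\<^sub>R \<alpha>"

text \<open>A root system spans the whole ambient Euclidean space, so its rank is the dimension
  of the ambient type.\<close>

definition finite_root_system :: "'v::euclidean_space set \<Rightarrow> bool" where
  "finite_root_system R \<longleftrightarrow>
     finite R \<and> span R = UNIV \<and> 0 \<notin> R \<and>
     (\<forall>\<alpha>\<in>R. root_refl \<alpha> ` R = R) \<and>
     (\<forall>\<alpha>\<in>R. \<forall>\<beta>\<in>R. \<beta> \<bullet> coroot \<alpha> \<in> \<int>)"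

definition reduced_roots :: "'v::euclidean_space set \<Rightarrow> bool" where
  "reduced_roots R \<longleftrightarrow> (\<forall>\<alpha>\<in>R. range (\<lambda>c. c *\<^sub>R \<alpha>) \<inter> R = {\<alpha>, - \<alpha>})"

definition irreducible_roots :: "'v::euclidean_space set \<Rightarrow> bool" where
  "irreducible_roots R \<longleftrightarrow>
     R \<noteq> {} \<and>
     \<not> (\<exists>A B. A \<noteq> {} \<and> B \<noteq> {} \<and> R = A \<union> B \<and> A \<inter> B = {} \<and> (\<forall>\<alpha>\<in>A. \<forall>\<beta>\<in>B. \<alpha> \<bullet> \<beta> = 0))"

text \<open>Meant for irreducible reduced systems, where at most two root lengths occur. If there is
  only one length, every root is long and none is short.\<close>

definition long_roots :: "'v::euclidean_space set \<Rightarrow> 'v set" where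
  "long_roots R = {\<alpha>\<in>R. \<forall>\<beta>\<in>R. norm \<beta> \<le> norm \<alpha>}"

definition short_roots :: "'v::euclidean_space set \<Rightarrow> 'v set" where
  "short_roots R = {\<alpha>\<in>R. \<exists>\<beta>\<in>R. norm \<alpha> < norm \<beta>}"

definition B2_roots :: "(real \<times> real) set" where
  "B2_roots = {(1,0), (-1,0), (0,1), (0,-1), (1,1), (1,-1), (-1,1), (-1,-1)}"

definition root_system_iso ::
  "'v::euclidean_space set \<Rightarrow> 'w::euclidean_space set \<Rightarrow> ('v \<Rightarrow> 'w) \<Rightarrow> bool" where
  "root_system_iso R S f \<longleftrightarrow>
     linear f \<and> bij f \<and> f ` R = S \<and>
     (\<forall>\<alpha>\<in>R. \<forall>\<beta>\<in>R. f \<beta> \<bullet> coroot (f \<alpha>) = \<beta> \<bullet> coroot \<alpha>)"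

definition type_B2 :: "'v::euclidean_space set \<Rightarrow> bool" where
  "type_B2 R \<longleftrightarrow> (\<exists>f. root_system_iso R B2_roots f)"

section \<open>Extension data and affine reflection systems\<close>

text \<open>The vector space \<open>Y\<close> is a finite-dimensional subspace of a type rather than a whole type of
  class \<open>euclidean_space\<close>, because such a type is never zero-dimensional and \<open>Y = 0\<close> is allowed.
  Only the values of \<open>\<Lambda>\<close> on \<open>R \<union> {0}\<close> matter.\<close>

definition extension_datum ::
  "'v::euclidean_space set \<Rightarrow> 'y::real_vector set \<Rightarrow> ('v \<Rightarrow> 'y set) \<Rightarrow> bool" where
  "extension_datum R Y \<Lambda> \<longleftrightarrow>
     (\<exists>B. finite B \<and> Y = span B) \<and>
     (\<forall>\<alpha>\<in>R. \<forall>\<beta>\<in>R. {z - (\<beta> \<bullet> coroot \<alpha>) *\<^sub>R y |z y. z \<in> \<Lambda> \<beta> \<and> y \<in> \<Lambda> \<alpha>} \<subseteq> \<Lambda> (root_refl \<alpha> \<beta>)) \<and>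
     (\<forall>\<alpha>\<in>R \<union> {0}. 0 \<in> \<Lambda> \<alpha>) \<and>
     span (\<Union>\<alpha>\<in>R \<union> {0}. \<Lambda> \<alpha>) = Y"

text \<open>For irreducible \<open>R\<close> the sets \<open>\<Lambda> \<alpha>\<close> depend only on the length of the root \<open>\<alpha>\<close>, so these
  definite descriptions denote the common values.\<close>

definition \<Lambda>_long :: "'v::euclidean_space set \<Rightarrow> ('v \<Rightarrow> 'y set) \<Rightarrow> 'y set" where
  "\<Lambda>_long R \<Lambda> = (THE L. \<forall>\<alpha>\<in>long_roots R. \<Lambda> \<alpha> = L)"

definition \<Lambda>_short :: "'v::euclidean_space set \<Rightarrow> ('v \<Rightarrow> 'y set) \<Rightarrow> 'y set" where
  "\<Lambda>_short R \<Lambda> =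
     (if short_roots R = {} then \<Lambda>_long R \<Lambda> else (THE L. \<forall>\<alpha>\<in>short_roots R. \<Lambda> \<alpha> = L))"

definition additive_subgroup :: "'y::real_vector set \<Rightarrow> bool" where
  "additive_subgroup S \<longleftrightarrow> 0 \<in> S \<and> (\<forall>x\<in>S. \<forall>y\<in>S. x + y \<in> S) \<and> (\<forall>x\<in>S. - x \<in> S)"

text \<open>The element \<open>\<alpha> \<oplus> y\<close> of \<open>V \<oplus> Y\<close> is the pair \<open>(\<alpha>, y)\<close>, and \<open>\<alpha> \<oplus> S\<close> is \<open>{\<alpha>} \<times> S\<close>.\<close>

definition affine_roots :: "'v::euclidean_space set \<Rightarrow> ('v \<Rightarrow> 'y::real_vector set) \<Rightarrow> ('v \<times> 'y) set" where
  "affine_roots R \<Lambda> = (\<Union>\<alpha>\<in>R \<union> {0}. {\<alpha>} \<times> \<Lambda> \<alpha>)"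

definition real_roots :: "'v::euclidean_space set \<Rightarrow> ('v \<Rightarrow> 'y::real_vector set) \<Rightarrow> ('v \<times> 'y) set" where
  "real_roots R \<Lambda> = (\<Union>\<alpha>\<in>R. {\<alpha>} \<times> \<Lambda> \<alpha>)"

definition affine_refl ::
  "'v::euclidean_space \<times> 'y::real_vector \<Rightarrow> 'v \<times> 'y \<Rightarrow> 'v \<times> 'y" where
  "affine_refl a b =
     (root_refl (fst a) (fst b), snd b - (fst b \<bullet> coroot (fst a)) *\<^sub>R snd a)"

definition gradient ::
  "'v::euclidean_space set \<Rightarrow> ('v \<Rightarrow> 'y::real_vector set) \<Rightarrow> ('v \<times> 'y) set \<Rightarrow> 'v set" where
  "gradient R \<Lambda> \<Psi> = {\<alpha>\<in>R. \<exists>y\<in>\<Lambda> \<alpha>. (\<alpha>, y) \<in> \<Psi>}"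

section \<open>Closed subroot systems\<close>

text \<open>The ambient set \<open>R\<close> with reflections \<open>s\<close> is instantiated both by a finite root system
  (with \<^const>\<open>root_refl\<close>) and by the set of real roots (with \<^const>\<open>affine_refl\<close>).
  Subroot systems are proper and non-empty by definition.\<close>

definition subroot_system :: "('a \<Rightarrow> 'a \<Rightarrow> 'a) \<Rightarrow> 'a set \<Rightarrow> 'a set \<Rightarrow> bool" where
  "subroot_system s R \<Psi> \<longleftrightarrow> \<Psi> \<noteq> {} \<and> \<Psi> \<subset> R \<and> (\<forall>a\<in>\<Psi>. \<forall>b\<in>\<Psi>. s a b \<in> \<Psi>)"

definition closed_in_roots :: "'a::plus set \<Rightarrow> 'a set \<Rightarrow> bool" where
  "closed_in_roots R \<Psi> \<longleftrightarrow> (\<forall>a\<in>\<Psi>. \<forall>b\<in>\<Psi>. a + b \<in> R \<longrightarrow> a + b \<in> \<Psi>)"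

definition closed_subroot_system :: "('a \<Rightarrow> 'a \<Rightarrow> 'a) \<Rightarrow> 'a::plus set \<Rightarrow> 'a set \<Rightarrow> bool" where
  "closed_subroot_system s R \<Psi> \<longleftrightarrow> subroot_system s R \<Psi> \<and> closed_in_roots R \<Psi>"

definition maximal_closed_subroot_system ::
  "('a \<Rightarrow> 'a \<Rightarrow> 'a) \<Rightarrow> 'a::plus set \<Rightarrow> 'a set \<Rightarrow> bool" where
  "maximal_closed_subroot_system s R \<Psi> \<longleftrightarrow>
     closed_subroot_system s R \<Psi> \<and>
     \<not> (\<exists>\<Psi>'. closed_subroot_system s R \<Psi>' \<and> \<Psi> \<subset> \<Psi>' \<and> \<Psi>' \<subset> R)"

definition proper_closed_gradient ::
  "'v::euclidean_space set \<Rightarrow> ('v \<Rightarrow> 'y::real_vector set) \<Rightarrow> ('v \<times> 'y) set \<Rightarrow> bool" where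
  "proper_closed_gradient R \<Lambda> \<Psi> \<longleftrightarrow>
     gradient R \<Lambda> \<Psi> \<subset> R \<and> closed_in_roots R (gradient R \<Lambda> \<Psi>)"

end

theory Submission
  imports Defs
begin

text \<open>If \<open>\<Psi>\<close> is maximal with proper closed gradient, the full preimage of its gradient is closed
  and contains \<open>\<Psi>\<close>, so it equals \<open>\<Psi>\<close>. If moreover the gradient has no short root, it consists of
  all long roots; then \<open>\<Lambda>\<^sub>\<ell>\<close> is a group and \<open>\<Psi>\<close> lies in the closed subroot system \<open>R \<oplus> \<Lambda>\<^sub>\<ell>\<close>,
  which is everything only if \<open>\<Lambda>\<^sub>\<ell> = \<Lambda>\<^sub>s\<close>.

  Conversely, let \<open>\<Psi>\<close> be closed and properly contain the full preimage of a maximal \<open>S\<close>. The set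
  \<open>A\<close> of roots over which \<open>\<Psi>\<close> is full is closed and contains \<open>S\<close>, so \<open>A = S\<close> unless \<open>\<Psi>\<close> is
  everything. If \<open>A = S\<close>, a root \<open>\<delta>\<close> of \<open>D = gradient \<Psi> - S\<close> and a root \<open>\<gamma>\<close> of \<open>S\<close> can sum to
  a root only when \<open>\<delta>\<close> is short, \<open>\<gamma>\<close> is long and \<open>\<Lambda>\<^sub>\<ell> \<noteq> \<Lambda>\<^sub>s\<close>: otherwise additivity of \<open>\<Lambda>\<close> makes
  \<open>\<Psi>\<close> full over \<open>\<delta> + \<gamma>\<close>, whence \<open>\<delta> \<in> S\<close>. So the part \<open>M\<close> of \<open>S\<close> orthogonal to \<open>D\<close> is
  non-empty, and \<open>M\<close> together with its strong orthogonal complement \<open>T\<close> is a closed subroot system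
  properly containing \<open>S\<close>. It is therefore all of \<open>R\<close>, which contradicts irreducibility.\<close>

section \<open>Reflections and coroot pairings\<close>

lemma inner_coroot: "v \<bullet> coroot \<alpha> = 2 * (v \<bullet> \<alpha>) / (\<alpha> \<bullet> \<alpha>)"
  by (simp add: coroot_def)

lemma root_refl_add:
  assumes "v \<bullet> coroot \<alpha> = - 1"
  shows "root_refl \<alpha> v = \<alpha> + v"
  using assms by (simp add: root_refl_def)

lemma inner_root_refl:
  "v \<bullet> root_refl \<alpha> w = v \<bullet> w - (w \<bullet> coroot \<alpha>) * (v \<bullet> \<alpha>)"
  by (simp add: root_refl_def inner_diff_right)

lemma root_refl_orthogonal: "v \<bullet> \<alpha> = 0 \<Longrightarrow> root_refl \<alpha> v = v"
  by (simp add: root_refl_def inner_coroot)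

lemma root_refl_self: "\<alpha> \<noteq> 0 \<Longrightarrow> root_refl \<alpha> \<alpha> = - \<alpha>"
  by (simp add: root_refl_def inner_coroot scaleR_2)

lemma root_refl_plus: "root_refl \<alpha> (v + w) = root_refl \<alpha> v + root_refl \<alpha> w"
  by (simp add: root_refl_def inner_add_left algebra_simps)

lemma inner_root_refl_root_refl: "root_refl \<alpha> v \<bullet> root_refl \<alpha> w = v \<bullet> w"
proof (cases "\<alpha> = 0")
  case False
  then have "\<alpha> \<bullet> \<alpha> \<noteq> 0" by simp
  then show ?thesis
    by (simp add: root_refl_def inner_coroot inner_diff_left inner_diff_right inner_commute
        field_simps)
qed (simp add: root_refl_def)

lemma norm_root_refl: "norm (root_refl \<alpha> v) = norm v"
  by (simp add: norm_eq_sqrt_inner inner_root_refl_root_refl)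

lemma root_refl_involution: "root_refl \<alpha> (root_refl \<alpha> v) = v"
proof (cases "\<alpha> = 0")
  case False
  then have "root_refl \<alpha> v \<bullet> coroot \<alpha> = - (v \<bullet> coroot \<alpha>)"
    by (simp add: root_refl_def inner_coroot inner_diff_left field_simps)
  then show ?thesis by (simp add: root_refl_def[of \<alpha> "root_refl \<alpha> v"]) (simp add: root_refl_def)
qed (simp add: root_refl_def)

section \<open>Irreducible reduced root systems: long and short roots\<close>

locale irreducible_root_system =
  fixes R :: "'v::euclidean_space set"
  assumes root_system: "finite_root_system R"
    and reduced: "reduced_roots R"
    and irreducible: "irreducible_roots R"
begin

lemma finite_R: "finite R"
  and span_R: "span R = UNIV"
  and root_nz: "\<alpha> \<in> R \<Longrightarrow> \<alpha> \<noteq> 0"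
  and refl_in: "\<alpha> \<in> R \<Longrightarrow> \<beta> \<in> R \<Longrightarrow> root_refl \<alpha> \<beta> \<in> R"
  and pairing_int: "\<alpha> \<in> R \<Longrightarrow> \<beta> \<in> R \<Longrightarrow> \<beta> \<bullet> coroot \<alpha> \<in> \<int>"
  using root_system by (auto simp: finite_root_system_def)

lemma R_nonempty: "R \<noteq> {}"
  using irreducible by (simp add: irreducible_roots_def)

lemma root_inner_pos: "\<alpha> \<in> R \<Longrightarrow> \<alpha> \<bullet> \<alpha> > 0"
  using root_nz by simp

lemma uminus_root: "\<alpha> \<in> R \<Longrightarrow> - \<alpha> \<in> R"
  using refl_in[of \<alpha> \<alpha>] root_nz[of \<alpha>] by (simp add: root_refl_self)

lemma not_decomposable:
  assumes "A \<noteq> {}" "B \<noteq> {}" "R = A \<union> B" "\<And>\<alpha> \<beta>. \<alpha> \<in> A \<Longrightarrow> \<beta> \<in> B \<Longrightarrow> \<alpha> \<bullet> \<beta> = 0"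
  shows False
proof -
  have "\<alpha> \<notin> A \<inter> B" for \<alpha>
    using assms(3,4) root_nz by (metis IntD1 IntD2 UnCI inner_eq_zero_iff)
  then have "A \<inter> B = {}" by blast
  with assms irreducible show False unfolding irreducible_roots_def by blast
qed

lemma long_or_short: "\<alpha> \<in> R \<Longrightarrow> \<alpha> \<in> long_roots R \<or> \<alpha> \<in> short_roots R"
  by (auto simp: long_roots_def short_roots_def not_le)

lemma short_iff: "\<alpha> \<in> R \<Longrightarrow> \<alpha> \<in> short_roots R \<longleftrightarrow> \<alpha> \<notin> long_roots R"
  by (auto simp: long_roots_def short_roots_def not_le)

lemma long_in: "\<alpha> \<in> long_roots R \<Longrightarrow> \<alpha> \<in> R"
  and short_in: "\<alpha> \<in> short_roots R \<Longrightarrow> \<alpha> \<in> R"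
  by (auto simp: long_roots_def short_roots_def)

lemma norm_le_long: "\<alpha> \<in> long_roots R \<Longrightarrow> \<beta> \<in> R \<Longrightarrow> norm \<beta> \<le> norm \<alpha>"
  by (auto simp: long_roots_def)

lemma inner_le_long: "\<alpha> \<in> long_roots R \<Longrightarrow> \<beta> \<in> R \<Longrightarrow> \<beta> \<bullet> \<beta> \<le> \<alpha> \<bullet> \<alpha>"
  using norm_le_long by (simp add: norm_le)

lemma long_norm_eq: "\<alpha> \<in> long_roots R \<Longrightarrow> \<beta> \<in> long_roots R \<Longrightarrow> norm \<alpha> = norm \<beta>"
  by (meson long_in norm_le_long order_antisym)

lemma long_by_norm: "\<alpha> \<in> long_roots R \<Longrightarrow> \<beta> \<in> R \<Longrightarrow> norm \<beta> = norm \<alpha> \<Longrightarrow> \<beta> \<in> long_roots R"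
  by (auto simp: long_roots_def)

lemma short_by_norm: "\<alpha> \<in> short_roots R \<Longrightarrow> \<beta> \<in> R \<Longrightarrow> norm \<beta> = norm \<alpha> \<Longrightarrow> \<beta> \<in> short_roots R"
  by (auto simp: short_roots_def)

lemma uminus_long: "\<alpha> \<in> long_roots R \<Longrightarrow> - \<alpha> \<in> long_roots R"
  by (metis long_by_norm long_in norm_minus_cancel uminus_root)

lemma uminus_short: "\<alpha> \<in> short_roots R \<Longrightarrow> - \<alpha> \<in> short_roots R"
  by (metis short_by_norm short_in norm_minus_cancel uminus_root)

lemma long_exists: "long_roots R \<noteq> {}"
proof -
  have "Max (norm ` R) \<in> norm ` R"
    using finite_R R_nonempty by (intro Max_in) auto
  then obtain \<alpha> where "\<alpha> \<in> R" "norm \<alpha> = Max (norm ` R)" by auto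
  then have "\<alpha> \<in> long_roots R"
    using finite_R by (auto simp: long_roots_def)
  then show ?thesis by blast
qed

section \<open>Integrality of pairings and sums of roots\<close>

lemma pairing_long:
  assumes "\<alpha> \<in> long_roots R" "\<beta> \<in> R" "\<alpha> \<bullet> \<beta> < 0" "\<beta> \<noteq> - \<alpha>"
  shows "\<beta> \<bullet> coroot \<alpha> = - 1"
proof -
  have \<alpha>: "\<alpha> \<in> R" using assms long_in by blast
  obtain n :: int where n: "\<beta> \<bullet> coroot \<alpha> = of_int n"
    using pairing_int[OF \<alpha> assms(2)] by (auto elim: Ints_cases)
  have pos: "\<alpha> \<bullet> \<alpha> > 0" using \<alpha> by (rule root_inner_pos)
  have eq: "2 * (\<alpha> \<bullet> \<beta>) = of_int n * (\<alpha> \<bullet> \<alpha>)"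
    using n pos by (simp add: inner_coroot field_simps inner_commute)
  have "n < 0"
    using eq assms(3) pos by (smt (verit) mult_nonneg_nonneg of_int_0_le_iff)
  moreover have "n > - 2"
  proof (rule ccontr)
    assume "\<not> n > - 2"
    then have "real_of_int n \<le> - 2" by linarith
    then have "of_int n * (\<alpha> \<bullet> \<alpha>) \<le> - 2 * (\<alpha> \<bullet> \<alpha>)"
      using pos by (intro mult_right_mono) auto
    then have "(\<alpha> + \<beta>) \<bullet> (\<alpha> + \<beta>) \<le> 0"
      using eq inner_le_long[OF assms(1,2)]
      by (simp add: inner_add_left inner_add_right inner_commute)
    then have "\<alpha> + \<beta> = 0" by (metis inner_gt_zero_iff not_le)
    with assms(4) show False by (simp add: add_eq_0_iff)
  qed
  ultimately have "n = - 1" by linarith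
  with n show ?thesis by simp
qed

text \<open>The sum is no longer than \<alpha>, while \<beta> contributes a positive amount to its
  squared length, so the inner product must be negative and \<open>pairing_long\<close>
  applies.\<close>

lemma long_plus_root:
  assumes "\<alpha> \<in> long_roots R" "\<beta> \<in> R" "\<alpha> + \<beta> \<in> R"
  shows "\<beta> \<bullet> coroot \<alpha> = - 1"
proof (rule pairing_long[OF assms(1,2)])
  have "(\<alpha> + \<beta>) \<bullet> (\<alpha> + \<beta>) \<le> \<alpha> \<bullet> \<alpha>" using assms inner_le_long by blast
  with root_inner_pos[OF assms(2)] show "\<alpha> \<bullet> \<beta> < 0"
    by (simp add: inner_add_left inner_add_right inner_commute del: inner_gt_zero_iff)
  show "\<beta> \<noteq> - \<alpha>" using assms(3) root_nz by force
qed

lemma norm_long_plus: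
  assumes "\<alpha> \<in> long_roots R" "\<beta> \<in> R" "\<alpha> + \<beta> \<in> R"
  shows "norm (\<alpha> + \<beta>) = norm \<beta>"
  using long_plus_root[OF assms] by (metis norm_root_refl root_refl_add)

lemma proportional_roots:
  assumes "\<alpha> \<in> R" "\<beta> \<in> R" "\<beta> = c *\<^sub>R \<alpha>"
  shows "\<beta> = \<alpha> \<or> \<beta> = - \<alpha>"
  using assms reduced unfolding reduced_roots_def by blast

text \<open>The product is four times the squared cosine of the angle. Equality in Cauchy-Schwarz
  would make the roots proportional, which reducedness allows only up to sign.\<close>

lemma pairing_product:
  assumes "\<alpha> \<in> R" "\<beta> \<in> R" "\<beta> \<noteq> \<alpha>" "\<beta> \<noteq> - \<alpha>"
  shows "(\<beta> \<bullet> coroot \<alpha>) * (\<alpha> \<bullet> coroot \<beta>) < 4"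
proof -
  have pos: "\<alpha> \<bullet> \<alpha> > 0" "\<beta> \<bullet> \<beta> > 0" using assms root_inner_pos by auto
  have "\<bar>\<alpha> \<bullet> \<beta>\<bar> \<noteq> norm \<alpha> * norm \<beta>"
  proof
    assume "\<bar>\<alpha> \<bullet> \<beta>\<bar> = norm \<alpha> * norm \<beta>"
    then have "norm \<alpha> *\<^sub>R \<beta> = norm \<beta> *\<^sub>R \<alpha> \<or> norm \<alpha> *\<^sub>R \<beta> = - norm \<beta> *\<^sub>R \<alpha>"
      by (simp add: norm_cauchy_schwarz_abs_eq)
    then obtain d where d: "norm \<alpha> *\<^sub>R \<beta> = d *\<^sub>R \<alpha>" by blast
    have "\<beta> = (d / norm \<alpha>) *\<^sub>R \<alpha>"
    proof -
      have "\<beta> = (1 / norm \<alpha>) *\<^sub>R (norm \<alpha> *\<^sub>R \<beta>)" using pos by simp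
      then show ?thesis unfolding d by simp
    qed
    with assms proportional_roots show False by blast
  qed
  then have "\<bar>\<alpha> \<bullet> \<beta>\<bar> < norm \<alpha> * norm \<beta>"
    using Cauchy_Schwarz_ineq2[of \<alpha> \<beta>] by simp
  then have "\<bar>\<alpha> \<bullet> \<beta>\<bar>\<^sup>2 < (norm \<alpha> * norm \<beta>)\<^sup>2"
    by (intro power_strict_mono) auto
  then have "(\<alpha> \<bullet> \<beta>)\<^sup>2 < (\<alpha> \<bullet> \<alpha>) * (\<beta> \<bullet> \<beta>)"
    by (simp add: power_mult_distrib power2_norm_eq_inner)
  then show ?thesis
    using pos by (simp add: inner_coroot inner_commute power2_eq_square field_simps)
qed

text \<open>The two pairings are non-zero integers of equal sign with product below 4, and the one
  against the longer root has the smaller absolute value, hence absolute value 1. The other one is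
  then the ratio of squared lengths, up to sign. The proportional case is a disjunct under the
  quantifier.\<close>

lemma inner_ratio:
  assumes "\<alpha> \<in> R" "\<beta> \<in> R" "\<alpha> \<bullet> \<beta> \<noteq> 0" "norm \<alpha> \<le> norm \<beta>"
  shows "\<exists>m\<in>{1,2,3}. \<beta> \<bullet> \<beta> = m * (\<alpha> \<bullet> \<alpha>) \<and> \<bar>\<alpha> \<bullet> coroot \<beta>\<bar> = 1 \<or> \<beta> = \<alpha> \<or> \<beta> = - \<alpha>"
proof (cases "\<beta> = \<alpha> \<or> \<beta> = - \<alpha>")
  case False
  obtain n m :: int where n: "\<alpha> \<bullet> coroot \<beta> = of_int n" and m: "\<beta> \<bullet> coroot \<alpha> = of_int m"
    using pairing_int assms(1,2) by (metis Ints_cases)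
  have pos: "\<alpha> \<bullet> \<alpha> > 0" "\<beta> \<bullet> \<beta> > 0" using assms root_inner_pos by auto
  have n': "2 * (\<alpha> \<bullet> \<beta>) = of_int n * (\<beta> \<bullet> \<beta>)"
    using n pos by (simp add: inner_coroot field_simps)
  have m': "2 * (\<alpha> \<bullet> \<beta>) = of_int m * (\<alpha> \<bullet> \<alpha>)"
    using m pos by (simp add: inner_coroot field_simps inner_commute)
  have "real_of_int (m * n) < 4" using pairing_product[of \<alpha> \<beta>] assms False n m by simp
  then have "m * n < 4" by linarith
  have n0: "n \<noteq> 0" "m \<noteq> 0" using n' m' assms(3) by auto
  have eq: "of_int \<bar>n\<bar> * (\<beta> \<bullet> \<beta>) = of_int \<bar>m\<bar> * (\<alpha> \<bullet> \<alpha>)"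
    using arg_cong[OF trans[OF n'[symmetric] m'], of abs] pos by (simp add: abs_mult)
  have le: "\<alpha> \<bullet> \<alpha> \<le> \<beta> \<bullet> \<beta>" using assms(4) by (simp add: norm_le)
  have "real_of_int \<bar>n\<bar> \<le> of_int \<bar>m\<bar>"
  proof (rule ccontr)
    assume "\<not> ?thesis"
    then have "of_int \<bar>m\<bar> * (\<alpha> \<bullet> \<alpha>) < of_int \<bar>n\<bar> * (\<alpha> \<bullet> \<alpha>)" using pos by simp
    also have "\<dots> \<le> of_int \<bar>n\<bar> * (\<beta> \<bullet> \<beta>)" using le by (intro mult_left_mono) auto
    finally show False using eq by simp
  qed
  then have nm: "\<bar>n\<bar> \<le> \<bar>m\<bar>" by linarith
  have "m * n > 0"
  proof -
    have "(of_int m * (\<alpha> \<bullet> \<alpha>)) * (of_int n * (\<beta> \<bullet> \<beta>)) > 0"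
      using n' m' assms(3) by (metis mult_eq_0_iff not_real_square_gt_zero zero_neq_numeral)
    then have "real_of_int (m * n) * ((\<alpha> \<bullet> \<alpha>) * (\<beta> \<bullet> \<beta>)) > 0" by (simp add: mult_ac)
    then have "real_of_int (m * n) > 0" using pos by (metis mult_pos_pos zero_less_mult_pos2)
    then show ?thesis by linarith
  qed
  with \<open>m * n < 4\<close> have mn: "\<bar>m\<bar> * \<bar>n\<bar> < 4" by (simp flip: abs_mult)
  have "\<bar>n\<bar> = 1"
  proof (rule ccontr)
    assume "\<bar>n\<bar> \<noteq> 1"
    then have "\<bar>n\<bar> \<ge> 2" using n0 by linarith
    then have "2 * 2 \<le> \<bar>m\<bar> * \<bar>n\<bar>" using nm by (intro mult_mono) auto
    with mn show False by simp
  qed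
  with mn n0 have "\<bar>m\<bar> \<in> {1,2,3}" by auto
  then have "real_of_int \<bar>m\<bar> \<in> {1,2,3}" by auto
  moreover have "\<beta> \<bullet> \<beta> = of_int \<bar>m\<bar> * (\<alpha> \<bullet> \<alpha>)" using eq \<open>\<bar>n\<bar> = 1\<close> by simp
  moreover have "\<bar>\<alpha> \<bullet> coroot \<beta>\<bar> = 1" using n \<open>\<bar>n\<bar> = 1\<close> by (metis of_int_1 of_int_abs)
  ultimately show ?thesis by blast
qed auto

text \<open>The shorter root has pairing -1 against the longer one, so the sum is the reflection of
  the shorter root.\<close>

lemma root_sum:
  assumes "\<alpha> \<in> R" "\<beta> \<in> R" "\<alpha> \<bullet> \<beta> < 0" "\<beta> \<noteq> - \<alpha>"
  shows "\<alpha> + \<beta> \<in> R"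
proof -
  have main: "a + b \<in> R"
    if "a \<in> R" "b \<in> R" "a \<bullet> b < 0" "b \<noteq> - a" "norm a \<le> norm b" for a b
  proof -
    have "b \<noteq> a" using that(3) by (metis inner_ge_zero not_le)
    then have "\<bar>a \<bullet> coroot b\<bar> = 1" using inner_ratio[of a b] that by auto
    moreover have "a \<bullet> coroot b < 0"
      using that root_inner_pos[of b] by (simp add: inner_coroot divide_less_0_iff)
    ultimately have "root_refl b a = b + a" by (intro root_refl_add) linarith
    then show ?thesis using refl_in that by (metis add.commute)
  qed
  show ?thesis
  proof (cases "norm \<alpha> \<le> norm \<beta>")
    case False
    have "\<beta> + \<alpha> \<in> R" using assms False by (intro main) (auto simp: inner_commute)
    then show ?thesis by (simp add: add.commute)
  qed (use main assms in blast)
qed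

section \<open>Consequences of irreducibility: at most two root lengths\<close>

lemma invariant_nonorthogonal:
  assumes "C \<subseteq> R" "C \<noteq> {}" "\<And>\<gamma> c. \<gamma> \<in> R \<Longrightarrow> c \<in> C \<Longrightarrow> root_refl \<gamma> c \<in> C" "\<beta> \<in> R"
  obtains c where "c \<in> C" "c \<bullet> \<beta> \<noteq> 0"
proof (rule ccontr)
  assume neg: "\<not> thesis"
  define B where "B = {\<beta>\<in>R. \<forall>c\<in>C. c \<bullet> \<beta> = 0}"
  have "\<beta> \<in> B" using neg that assms(4) by (auto simp: B_def)
  show False
  proof (rule not_decomposable[of B "R - B"])
    show "B \<noteq> {}" using \<open>\<beta> \<in> B\<close> by blast
    show "R - B \<noteq> {}"
    proof -
      obtain c where "c \<in> C" using assms(2) by blast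
      moreover from this have "c \<in> R" "c \<bullet> c \<noteq> 0" using assms(1) root_nz by auto
      ultimately have "c \<in> R - B" unfolding B_def by blast
      then show ?thesis by blast
    qed
    show "R = B \<union> (R - B)" by (auto simp: B_def)
    fix b a assume b: "b \<in> B" and a: "a \<in> R - B"
    then obtain c where c: "c \<in> C" "c \<bullet> a \<noteq> 0" by (auto simp: B_def)
    have "root_refl a c \<in> C" using assms(3) a c by blast
    \<comment> \<open>The vectors \<open>c\<close> and \<open>root_refl a c\<close> differ by a
      non-zero multiple of \<open>a\<close>, so \<open>b\<close>, being orthogonal to both, is
      orthogonal to \<open>a\<close>.\<close>
    then have "b \<bullet> root_refl a c = 0" "b \<bullet> c = 0"
      using b c by (auto simp: B_def inner_commute)
    then have "(c \<bullet> coroot a) * (b \<bullet> a) = 0" by (simp add: inner_root_refl)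
    moreover have "c \<bullet> coroot a \<noteq> 0" using c a root_nz by (simp add: inner_coroot)
    ultimately show "b \<bullet> a = 0" by simp
  qed
qed

lemma same_norm_nonorthogonal:
  assumes "\<alpha> \<in> R" "\<beta> \<in> R"
  obtains \<alpha>' where "\<alpha>' \<in> R" "norm \<alpha>' = norm \<alpha>" "\<alpha>' \<bullet> \<beta> \<noteq> 0"
proof -
  obtain c where "c \<in> {c\<in>R. norm c = norm \<alpha>}" "c \<bullet> \<beta> \<noteq> 0"
    by (rule invariant_nonorthogonal[of "{c\<in>R. norm c = norm \<alpha>}" \<beta>])
      (use assms refl_in in \<open>auto simp: norm_root_refl\<close>)
  with that show thesis by blast
qed

text \<open>\<alpha> may be orthogonal to \<beta>; a root of the same length that is not orthogonal
  to \<beta> takes its place in \<open>inner_ratio\<close>.\<close>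

lemma inner_ratio_lt:
  assumes "\<alpha> \<in> R" "\<beta> \<in> R" "norm \<alpha> < norm \<beta>"
  shows "\<beta> \<bullet> \<beta> \<in> {2 * (\<alpha> \<bullet> \<alpha>), 3 * (\<alpha> \<bullet> \<alpha>)}"
proof -
  obtain c where c: "c \<in> R" "norm c = norm \<alpha>" "c \<bullet> \<beta> \<noteq> 0"
    using same_norm_nonorthogonal assms by blast
  have "c \<bullet> c = \<alpha> \<bullet> \<alpha>" using c(2) by (simp add: norm_eq)
  moreover have "\<alpha> \<bullet> \<alpha> < \<beta> \<bullet> \<beta>" using assms(3) by (simp add: norm_lt)
  ultimately show ?thesis using inner_ratio[of c \<beta>] c assms by auto
qed

text \<open>Among three different lengths both consecutive squared ratios would be at least 2, so
  the extreme ratio would be at least 4, but it is at most 3.\<close>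

lemma short_norm_eq:
  assumes "\<alpha> \<in> short_roots R" "\<beta> \<in> short_roots R"
  shows "norm \<alpha> = norm \<beta>"
proof -
  have False if "a \<in> short_roots R" "b \<in> short_roots R" "norm a < norm b" for a b
  proof -
    from that obtain c where c: "c \<in> R" "norm b < norm c" by (auto simp: short_roots_def)
    have "a \<in> R" "b \<in> R" using that short_in by auto
    then show False
      using inner_ratio_lt[of a b] inner_ratio_lt[of b c] inner_ratio_lt[of a c] that c
        root_inner_pos[of a] by auto
  qed
  with assms show ?thesis by (meson linorder_neqE_linordered_idom)
qed

lemma long_refl: "\<alpha> \<in> R \<Longrightarrow> \<beta> \<in> long_roots R \<Longrightarrow> root_refl \<alpha> \<beta> \<in> long_roots R"
  using long_by_norm long_in norm_root_refl refl_in by blast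

lemma norm_eq_plus_pairing:
  assumes "\<alpha> \<in> R" "norm \<alpha> = norm \<beta>" "norm (\<alpha> + \<beta>) = norm \<alpha>"
  shows "\<beta> \<bullet> coroot \<alpha> = - 1"
proof -
  have "\<beta> \<bullet> \<beta> = \<alpha> \<bullet> \<alpha>" "(\<alpha> + \<beta>) \<bullet> (\<alpha> + \<beta>) = \<alpha> \<bullet> \<alpha>"
    using assms(2,3) by (simp_all add: norm_eq)
  then have "2 * (\<beta> \<bullet> \<alpha>) = - (\<alpha> \<bullet> \<alpha>)"
    by (simp add: inner_add_left inner_add_right inner_commute)
  then show ?thesis using root_inner_pos[OF assms(1)] by (simp add: inner_coroot field_simps)
qed

section \<open>Recognition of type B2\<close>

text \<open>The hypotheses exclude every type but \<open>C\<^sub>n\<close>; maximality of the long roots against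
  \<open>C\<^sub>1 \<times> C\<^bsub>n-1\<^esub>\<close>, the system \<open>S\<close> below, then forces \<open>n = 2\<close>.\<close>

lemma type_B2_if_orthogonal_long_roots:
  assumes max: "maximal_closed_subroot_system root_refl R (long_roots R)"
    and orth: "\<And>\<alpha> \<beta>. \<alpha> \<in> long_roots R \<Longrightarrow> \<beta> \<in> long_roots R \<Longrightarrow> \<alpha> \<bullet> \<beta> = 0 \<or> \<beta> = \<alpha> \<or> \<beta> = - \<alpha>"
    and short: "short_roots R \<noteq> {}"
  shows "type_B2 R"
proof -
  have nonorth: "\<gamma> \<bullet> \<beta> \<noteq> 0" if \<gamma>: "\<gamma> \<in> long_roots R" and \<beta>: "\<beta> \<in> short_roots R" for \<gamma> \<beta>
  proof
    assume perp: "\<gamma> \<bullet> \<beta> = 0"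
    have R: "\<gamma> \<in> R" "\<beta> \<in> R" using \<gamma> \<beta> long_in short_in by auto
    have m\<gamma>: "- \<gamma> \<in> long_roots R" using \<gamma> by (rule uminus_long)
    define T where "T = {\<alpha>\<in>R. \<alpha> \<bullet> \<gamma> = 0}"
    define S where "S = {\<gamma>, - \<gamma>} \<union> T"
    have "S \<subseteq> R" using R uminus_root by (auto simp: S_def T_def)
    moreover have "S \<noteq> R"
    proof
      assume "S = R"
      show False
      proof (rule not_decomposable)
        show "R = {\<gamma>, - \<gamma>} \<union> T" using \<open>S = R\<close> by (simp only: S_def)
        show "T \<noteq> {}" using R perp by (auto simp: T_def inner_commute)
      qed (auto simp: T_def inner_commute)
    qed
    moreover have "root_refl a b \<in> S" if "a \<in> S" "b \<in> S" for a b
    proof -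
      have "root_refl a b \<in> R" using that \<open>S \<subseteq> R\<close> refl_in by blast
      moreover have "root_refl a b \<in> {\<gamma>, - \<gamma>} \<or> root_refl a b \<bullet> \<gamma> = 0"
        using that root_nz[OF R(1)] inner_commute[of \<gamma> a] unfolding S_def T_def
        by (auto simp: root_refl_def inner_coroot inner_diff_left scaleR_2)
      ultimately show ?thesis by (auto simp: S_def T_def)
    qed
    moreover have "a + b \<in> S" if "a \<in> S" "b \<in> S" "a + b \<in> R" for a b
    proof -
      have *: "c \<notin> T" if "d \<in> {\<gamma>, - \<gamma>}" "d + c \<in> R" for c d
        using long_plus_root[of d c] that \<gamma> m\<gamma>
        by (auto simp: T_def inner_coroot inner_commute)
      have "\<gamma> + \<gamma> \<notin> R"
      proof
        assume "\<gamma> + \<gamma> \<in> R"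
        from norm_le_long[OF \<gamma> this] root_nz[OF R(1)] show False
          by (simp flip: scaleR_2)
      qed
      then have **: "c + d \<notin> R" if "c \<in> {\<gamma>, - \<gamma>}" "d \<in> {\<gamma>, - \<gamma>}" for c d
        using that uminus_root[of "- \<gamma> - \<gamma>"] root_nz[of 0] by auto
      \<comment> \<open>A sum that is a root cannot involve \<gamma> or its negative: with a member
        of \<open>T\<close> it would contradict \<open>long_plus_root\<close>, and within the pair
        it is zero or too long.\<close>
      have "a \<in> T \<and> b \<in> T"
        using that *[of a b] *[of b a] **[of a b] by (auto simp: S_def add.commute)
      with that show ?thesis by (auto simp: S_def T_def inner_add_left)
    qed
    ultimately have "closed_subroot_system root_refl R S"
      by (auto simp: closed_subroot_system_def subroot_system_def closed_in_roots_def S_def)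
    moreover have "long_roots R \<subset> S"
    proof
      show "long_roots R \<subseteq> S"
        using orth[OF \<gamma>] long_in by (auto simp: S_def T_def inner_commute)
      have "\<beta> \<in> S" "\<beta> \<notin> long_roots R"
        using R perp \<beta> short_iff by (auto simp: S_def T_def inner_commute)
      then show "long_roots R \<noteq> S" by blast
    qed
    ultimately show False
      using max unfolding maximal_closed_subroot_system_def closed_subroot_system_def
        subroot_system_def by blast
  qed
  \<comment> \<open>The vector is the reflection of \<gamma> in \<beta> once the ratio of squared
    lengths is known to be 2. The ratio 3 (as in G2) would give two long roots at 120 degrees,
    against \<open>orth\<close>.\<close>
  have partner: "\<gamma> + 2 *\<^sub>R \<beta> \<in> long_roots R \<and> \<gamma> \<bullet> (\<gamma> + 2 *\<^sub>R \<beta>) = 0"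
    if \<gamma>: "\<gamma> \<in> long_roots R" and \<beta>: "\<beta> \<in> short_roots R" and neg: "\<gamma> \<bullet> \<beta> < 0" for \<gamma> \<beta>
  proof -
    have R: "\<gamma> \<in> R" "\<beta> \<in> R" using \<gamma> \<beta> long_in short_in by auto
    have pos: "\<gamma> \<bullet> \<gamma> > 0" "\<beta> \<bullet> \<beta> > 0" using R root_inner_pos by auto
    have "norm \<beta> < norm \<gamma>"
      using \<gamma> \<beta> R by (metis long_by_norm norm_le_long order_le_imp_less_or_eq short_iff)
    then have ratio: "\<gamma> \<bullet> \<gamma> = 2 * (\<beta> \<bullet> \<beta>) \<or> \<gamma> \<bullet> \<gamma> = 3 * (\<beta> \<bullet> \<beta>)"
      using inner_ratio_lt R by blast
    have "\<beta> \<noteq> - \<gamma>" using \<open>norm \<beta> < norm \<gamma>\<close> by auto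
    then have half: "2 * (\<gamma> \<bullet> \<beta>) = - (\<gamma> \<bullet> \<gamma>)"
      using pairing_long[OF \<gamma> R(2) neg] pos by (simp add: inner_coroot inner_commute field_simps)
    have g: "root_refl \<beta> \<gamma> \<in> long_roots R" using long_refl R \<gamma> by blast
    have refl: "root_refl \<beta> \<gamma> = \<gamma> + ((\<gamma> \<bullet> \<gamma>) / (\<beta> \<bullet> \<beta>)) *\<^sub>R \<beta>"
      by (simp add: root_refl_def inner_coroot half)
    have "\<gamma> \<bullet> \<gamma> \<noteq> 3 * (\<beta> \<bullet> \<beta>)"
    proof
      assume "\<gamma> \<bullet> \<gamma> = 3 * (\<beta> \<bullet> \<beta>)"
      then have eq: "root_refl \<beta> \<gamma> = \<gamma> + 3 *\<^sub>R \<beta>" using pos refl by simp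
      then have "2 * (\<gamma> \<bullet> root_refl \<beta> \<gamma>) = - (\<gamma> \<bullet> \<gamma>)"
        using half by (simp add: inner_add_right)
      then show False using orth[OF \<gamma> g] pos by auto
    qed
    with ratio have "root_refl \<beta> \<gamma> = \<gamma> + 2 *\<^sub>R \<beta>" using pos refl by simp
    with g half show ?thesis by (simp add: inner_add_right)
  qed
  obtain a where a: "a \<in> long_roots R" using long_exists by blast
  obtain \<beta> where \<beta>: "\<beta> \<in> short_roots R" "a \<bullet> \<beta> < 0"
  proof -
    obtain \<beta> where "\<beta> \<in> short_roots R" using short by blast
    with nonorth[OF a this] that[of \<beta>] that[of "- \<beta>"] uminus_short[of \<beta>] show thesis by fastforce
  qed
  define b where "b = a + 2 *\<^sub>R \<beta>"
  have b: "b \<in> long_roots R" "a \<bullet> b = 0" using partner[OF a \<beta>] by (auto simp: b_def)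
  have \<beta>_eq: "\<beta> = (1/2) *\<^sub>R (b - a)" by (simp add: b_def)
  define N where "N = a \<bullet> a"
  have N: "a \<bullet> a = N" "b \<bullet> b = N" "N > 0"
    using long_norm_eq[OF a b(1)] root_inner_pos[OF long_in[OF a]] by (auto simp: N_def norm_eq)
  have ba: "b \<bullet> a = 0" using b(2) by (simp add: inner_commute)
  \<comment> \<open>\<open>f\<close> takes coordinates in the orthogonal basis formed by half of
    \<open>a + b\<close> and half of \<open>a - b\<close>, which become the short coordinate vectors
    of \<open>B2_roots\<close>; \<open>g\<close> is the inverse.\<close>
  define f where "f v = ((v \<bullet> a + v \<bullet> b) / N, (v \<bullet> a - v \<bullet> b) / N)" for v
  define g where "g p = ((fst p + snd p) / 2) *\<^sub>R a + ((fst p - snd p) / 2) *\<^sub>R b"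
    for p :: "real \<times> real"
  have fg: "f (g p) = p" for p
    using N by (simp add: f_def g_def inner_add_left b(2) ba field_simps prod_eq_iff)
  have linf: "linear f"
    by (rule linearI) (simp_all add: f_def inner_add_left algebra_simps add_divide_distrib diff_divide_distrib)
  have ling: "linear g"
    by (rule linearI) (simp_all add: g_def algebra_simps add_divide_distrib diff_divide_distrib)
  have long_ab: "\<gamma> \<in> {a, - a, b, - b}" if "\<gamma> \<in> long_roots R" for \<gamma>
  proof (rule ccontr)
    assume "\<gamma> \<notin> {a, - a, b, - b}"
    \<comment> \<open>By \<open>orth\<close>, a further long root is orthogonal to \<open>a\<close>
      and to \<open>b\<close>, hence to \<beta>, which is half their difference.\<close>
    then have "\<gamma> \<bullet> \<beta> = 0"
      using orth[OF a that] orth[OF b(1) that]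
      by (auto simp: \<beta>_eq inner_diff_right inner_commute)
    with nonorth that \<beta> show False by blast
  qed
  have R_eq: "R = g ` B2_roots"
  proof
    have "g (1, 0) = (1/2) *\<^sub>R (a + b)" "g (- 1, 0) = - ((1/2) *\<^sub>R (a + b))"
      "g (0, 1) = (1/2) *\<^sub>R (a - b)" "g (0, - 1) = (1/2) *\<^sub>R (b - a)"
      "g (1, 1) = a" "g (1, - 1) = b" "g (- 1, 1) = - b" "g (- 1, - 1) = - a"
      by (simp_all add: g_def algebra_simps)
    then have gB: "g ` B2_roots = {(1/2) *\<^sub>R (a + b), - ((1/2) *\<^sub>R (a + b)),
        (1/2) *\<^sub>R (a - b), (1/2) *\<^sub>R (b - a), a, b, - b, - a}"
      by (simp only: B2_roots_def image_insert image_empty)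
    show "R \<subseteq> g ` B2_roots"
    proof
      fix \<alpha> assume "\<alpha> \<in> R"
      then consider "\<alpha> \<in> long_roots R" | "\<alpha> \<in> short_roots R" using long_or_short by blast
      then show "\<alpha> \<in> g ` B2_roots"
      proof cases
        case 1
        then show ?thesis using long_ab unfolding gB by blast
      next
        case 2
        \<comment> \<open>\<open>partner\<close> turns \<open>d\<close> into a long root orthogonal
          to \<open>a\<close>, which must be \<open>b\<close> or \<open>- b\<close>; this determines
          \<open>d\<close>.\<close>
        have main: "d = (1/2) *\<^sub>R (b - a) \<or> d = - ((1/2) *\<^sub>R (a + b))"
          if "d \<in> short_roots R" "a \<bullet> d < 0" for d
        proof -
          define h where "h = a + 2 *\<^sub>R d"
          have h: "h \<in> long_roots R" "a \<bullet> h = 0" using partner[OF a that] by (auto simp: h_def)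
          then have "h = b \<or> h = - b" using long_ab N by fastforce
          moreover have "d = (1/2) *\<^sub>R (h - a)" by (simp add: h_def)
          moreover have "(1/2) *\<^sub>R (- b - a) = - ((1/2) *\<^sub>R (a + b))"
            by (simp add: algebra_simps)
          ultimately show ?thesis by auto
        qed
        consider "a \<bullet> \<alpha> < 0" | "a \<bullet> (- \<alpha>) < 0" using nonorth[OF a 2] by fastforce
        then show ?thesis
        proof cases
          case 1
          then show ?thesis using main[OF 2] unfolding gB by blast
        next
          case neg: 2
          have "\<alpha> = (1/2) *\<^sub>R (a - b) \<or> \<alpha> = (1/2) *\<^sub>R (a + b)"
            using main[OF uminus_short[OF 2] neg]
            by (metis minus_diff_eq minus_minus scaleR_minus_right)
          then show ?thesis unfolding gB by blast
        qed
      qed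
    qed
    have R: "a \<in> R" "b \<in> R" "\<beta> \<in> R" using a b \<beta> long_in short_in by auto
    have "root_refl a \<beta> = (1/2) *\<^sub>R (a + b)"
      using N ba by (simp add: root_refl_def inner_coroot \<beta>_eq inner_diff_left algebra_simps
          flip: scaleR_add_left)
    then have "(1/2) *\<^sub>R (a + b) \<in> R" "(1/2) *\<^sub>R (b - a) \<in> R"
      using refl_in[OF R(1,3)] R(3) \<beta>_eq by auto
    moreover from this have "(1/2) *\<^sub>R (a - b) \<in> R"
      by (metis minus_diff_eq scaleR_minus_right uminus_root)
    ultimately show "g ` B2_roots \<subseteq> R" unfolding gB using R uminus_root by blast
  qed
  have gf: "g (f v) = v" for v
  proof -
    have "linear (\<lambda>v. g (f v))" using linear_compose[OF linf ling] by (simp add: o_def)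
    then show ?thesis
      by (rule linear_eq_on_span[where f="\<lambda>v. g (f v)" and g="\<lambda>v. v" and B=R])
        (auto simp: span_R linear_iff, auto simp: R_eq fg)
  qed
  \<comment> \<open>\<open>g\<close> is a similarity, and coroot pairings do not change under
    rescaling of the inner product.\<close>
  have inner_g: "g p \<bullet> g q = N / 2 * (p \<bullet> q)" for p q
    using N b(2) ba by (simp add: g_def inner_add_left inner_add_right inner_prod_def algebra_simps)
      (simp add: field_simps)
  have inner_f: "f v \<bullet> f w = 2 / N * (v \<bullet> w)" for v w
    using inner_g[of "f v" "f w"] N by (simp add: gf field_simps)
  have "bij f" by (rule o_bij[of g]) (auto simp: fun_eq_iff fg gf)
  moreover have "f ` R = B2_roots" by (simp add: R_eq image_image fg)
  moreover have "f \<beta> \<bullet> coroot (f \<alpha>) = \<beta> \<bullet> coroot \<alpha>" for \<alpha> \<beta>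
    using N by (simp add: inner_coroot inner_f)
  ultimately show ?thesis
    using linf unfolding type_B2_def root_system_iso_def by blast
qed

end

section \<open>Real roots, maximality and subgroups in general\<close>

lemma mem_real_roots: "(\<alpha>, y) \<in> real_roots S \<Lambda> \<longleftrightarrow> \<alpha> \<in> S \<and> y \<in> \<Lambda> \<alpha>"
  by (auto simp: real_roots_def)

lemma gradient_eq:
  assumes "\<Psi> \<subseteq> real_roots R \<Lambda>"
  shows "gradient R \<Lambda> \<Psi> = fst ` \<Psi>"
  using assms by (force simp: gradient_def real_roots_def)

text \<open>Working form of maximality: non-emptiness of \<open>T\<close> is inherited from
  \<open>S\<close>, and properness is absorbed into the dichotomy.\<close>

lemma maximal_closed_subroot_systemD:
  assumes "maximal_closed_subroot_system s R S" "S \<subseteq> T" "T \<subseteq> R"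
    and "\<And>a b. a \<in> T \<Longrightarrow> b \<in> T \<Longrightarrow> s a b \<in> T"
    and "\<And>a b. a \<in> T \<Longrightarrow> b \<in> T \<Longrightarrow> a + b \<in> R \<Longrightarrow> a + b \<in> T"
  shows "T = S \<or> T = R"
proof (rule ccontr)
  assume "\<not> (T = S \<or> T = R)"
  then have "closed_subroot_system s R T" "S \<subset> T" "T \<subset> R"
    using assms
    by (auto simp: closed_subroot_system_def subroot_system_def closed_in_roots_def
        maximal_closed_subroot_system_def)
  with assms(1) show False unfolding maximal_closed_subroot_system_def by blast
qed

lemma scaleR_int_subgroup:
  assumes "additive_subgroup G" "y \<in> G" "c \<in> \<int>"
  shows "c *\<^sub>R y \<in> G"
proof -
  have nat: "real n *\<^sub>R y \<in> G" for n
    by (induction n) (use assms in \<open>auto simp: additive_subgroup_def scaleR_add_left\<close>)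
  obtain k :: int where k: "c = of_int k" using assms(3) by (auto elim: Ints_cases)
  show ?thesis
  proof (cases "k \<ge> 0")
    case True
    then show ?thesis using nat[of "nat k"] k by simp
  next
    case False
    then have "c *\<^sub>R y = - (real (nat (- k)) *\<^sub>R y)" using k by simp
    then show ?thesis using nat assms(1) by (metis additive_subgroup_def)
  qed
qed

section \<open>Extension data: invariance and additivity of the sets \<Lambda>\<close>

locale root_extension = irreducible_root_system R for R :: "'v::euclidean_space set" +
  fixes Y :: "'y::real_vector set" and \<Lambda> :: "'v \<Rightarrow> 'y set"
  assumes extension: "extension_datum R Y \<Lambda>"
begin

lemma refl_\<Lambda>:
  assumes "\<alpha> \<in> R" "\<beta> \<in> R" "z \<in> \<Lambda> \<beta>" "y \<in> \<Lambda> \<alpha>"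
  shows "z - (\<beta> \<bullet> coroot \<alpha>) *\<^sub>R y \<in> \<Lambda> (root_refl \<alpha> \<beta>)"
  using extension assms unfolding extension_datum_def by blast

lemma zero_\<Lambda>: "\<alpha> \<in> R \<Longrightarrow> 0 \<in> \<Lambda> \<alpha>"
  using extension unfolding extension_datum_def by blast

text \<open>The axiom with \<open>y = 0\<close> gives one inclusion; applied to the reflected root
  it gives the other, as reflections are involutions.\<close>

lemma \<Lambda>_root_refl:
  assumes "\<alpha> \<in> R" "\<beta> \<in> R"
  shows "\<Lambda> (root_refl \<alpha> \<beta>) = \<Lambda> \<beta>"
proof -
  have "\<Lambda> b \<subseteq> \<Lambda> (root_refl \<alpha> b)" if "b \<in> R" for b
    using refl_\<Lambda>[OF assms(1) that _ zero_\<Lambda>[OF assms(1)]] by auto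
  from this[OF assms(2)] this[OF refl_in[OF assms]] show ?thesis
    by (simp add: root_refl_involution)
qed

lemma \<Lambda>_uminus_root: "\<alpha> \<in> R \<Longrightarrow> \<Lambda> (- \<alpha>) = \<Lambda> \<alpha>"
  using \<Lambda>_root_refl[of \<alpha> \<alpha>] root_nz by (simp add: root_refl_self)

lemma uminus_\<Lambda>: "\<alpha> \<in> R \<Longrightarrow> y \<in> \<Lambda> \<alpha> \<Longrightarrow> - y \<in> \<Lambda> \<alpha>"
  using refl_\<Lambda>[of \<alpha> \<alpha> y y] \<Lambda>_root_refl[of \<alpha> \<alpha>] root_nz[of \<alpha>]
  by (simp add: inner_coroot scaleR_2)

text \<open>For pairing -1 the reflection of \<beta> is \<open>\<alpha> + \<beta>\<close>, and the
  axiom of an extension datum becomes additivity.\<close>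

lemma \<Lambda>_pairing:
  assumes "\<alpha> \<in> R" "\<beta> \<in> R" "\<beta> \<bullet> coroot \<alpha> = - 1"
  shows "\<Lambda> (\<alpha> + \<beta>) = \<Lambda> \<beta>" and "y \<in> \<Lambda> \<alpha> \<Longrightarrow> z \<in> \<Lambda> \<beta> \<Longrightarrow> y + z \<in> \<Lambda> \<beta>"
proof -
  show "\<Lambda> (\<alpha> + \<beta>) = \<Lambda> \<beta>" using \<Lambda>_root_refl assms by (metis root_refl_add)
  with refl_\<Lambda>[of \<alpha> \<beta> z y] show "y \<in> \<Lambda> \<alpha> \<Longrightarrow> z \<in> \<Lambda> \<beta> \<Longrightarrow> y + z \<in> \<Lambda> \<beta>"
    using assms by (simp add: root_refl_add add.commute)
qed

text \<open>The value of \<Lambda> is carried along as a further reflection invariant, because its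
  dependence on length alone, \<open>\<Lambda>_eq\<close>, is derived from this.\<close>

lemma same_norm_\<Lambda>_nonorthogonal:
  assumes "\<alpha> \<in> R" "\<beta> \<in> R"
  obtains \<alpha>' where "\<alpha>' \<in> R" "norm \<alpha>' = norm \<alpha>" "\<Lambda> \<alpha>' = \<Lambda> \<alpha>" "\<alpha>' \<bullet> \<beta> < 0"
proof -
  obtain c where "c \<in> {c\<in>R. norm c = norm \<alpha> \<and> \<Lambda> c = \<Lambda> \<alpha>}" "c \<bullet> \<beta> \<noteq> 0"
    by (rule invariant_nonorthogonal[of "{c\<in>R. norm c = norm \<alpha> \<and> \<Lambda> c = \<Lambda> \<alpha>}" \<beta>])
      (use assms refl_in in \<open>auto simp: norm_root_refl \<Lambda>_root_refl\<close>)
  with that[of c] that[of "- c"] show thesis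
    using uminus_root by (fastforce simp: \<Lambda>_uminus_root)
qed

text \<open>A root \<open>c\<close> of the same length with negative inner product, if not
  \<open>- \<beta>\<close>, has pairing -1 with \<beta> in both orders. Then
  \<open>\<beta> + c\<close> is a reflection of each of them, so \<Lambda> agrees on both.\<close>

lemma \<Lambda>_eq:
  assumes "\<alpha> \<in> R" "\<beta> \<in> R" "norm \<alpha> = norm \<beta>"
  shows "\<Lambda> \<alpha> = \<Lambda> \<beta>"
proof -
  obtain c where c: "c \<in> R" "norm c = norm \<beta>" "\<Lambda> c = \<Lambda> \<alpha>" "c \<bullet> \<beta> < 0"
    using same_norm_\<Lambda>_nonorthogonal[OF assms(1,2)] assms(3) by metis
  show ?thesis
  proof (cases "\<beta> = - c")
    case True
    then show ?thesis using c by (simp add: \<Lambda>_uminus_root)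
  next
    case False
    have "\<beta> \<noteq> c" using c(4) by (metis inner_ge_zero not_le)
    then have "\<bar>c \<bullet> coroot \<beta>\<bar> = 1" using inner_ratio[of c \<beta>] c assms(2) False by auto
    moreover have "c \<bullet> coroot \<beta> < 0"
      using c root_inner_pos[OF assms(2)] by (simp add: inner_coroot divide_less_0_iff)
    moreover have "\<beta> \<bullet> coroot c = c \<bullet> coroot \<beta>"
      using c(2) by (simp add: inner_coroot inner_commute norm_eq)
    ultimately have "\<Lambda> (\<beta> + c) = \<Lambda> c" "\<Lambda> (c + \<beta>) = \<Lambda> \<beta>"
      by (intro \<Lambda>_pairing(1); use c assms(2) in linarith)+
    then show ?thesis using c by (simp add: add.commute)
  qed
qed

lemma \<Lambda>_long_eq: "\<alpha> \<in> long_roots R \<Longrightarrow> \<Lambda>_long R \<Lambda> = \<Lambda> \<alpha>"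
  unfolding \<Lambda>_long_def by (rule the_equality) (use \<Lambda>_eq long_in long_norm_eq in blast)+

lemma \<Lambda>_short_eq: "\<alpha> \<in> short_roots R \<Longrightarrow> \<Lambda>_short R \<Lambda> = \<Lambda> \<alpha>"
  unfolding \<Lambda>_short_def
  by (simp, intro if_not_P conjI impI the_equality)
    (use \<Lambda>_eq short_in short_norm_eq in blast)+

text \<open>\<alpha> can be replaced by a root \<open>c\<close> of the same length with negative
  inner product with \<gamma>; as \<gamma> is long, the pairing is -1 and
  \<open>\<Lambda>_pairing\<close> applies.\<close>

lemma short_plus_long_\<Lambda>:
  assumes "\<alpha> \<in> short_roots R" "\<gamma> \<in> long_roots R" "y \<in> \<Lambda> \<gamma>" "z \<in> \<Lambda> \<alpha>"
  shows "y + z \<in> \<Lambda> \<alpha>"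
proof -
  have R: "\<alpha> \<in> R" "\<gamma> \<in> R" using assms long_in short_in by auto
  obtain c where c: "c \<in> R" "norm c = norm \<alpha>" "\<Lambda> c = \<Lambda> \<alpha>" "c \<bullet> \<gamma> < 0"
    using same_norm_\<Lambda>_nonorthogonal R by blast
  have "c \<noteq> - \<gamma>"
    using c(2) assms(1,2) by (metis R(1) long_by_norm norm_minus_cancel short_iff)
  then have "c \<bullet> coroot \<gamma> = - 1"
    using pairing_long c assms(2) by (metis inner_commute)
  with \<Lambda>_pairing(2)[of \<gamma> c y z] c R assms show ?thesis by simp
qed

lemma \<Lambda>_long_subset:
  assumes "\<alpha> \<in> R"
  shows "\<Lambda>_long R \<Lambda> \<subseteq> \<Lambda> \<alpha>"
proof (cases "\<alpha> \<in> long_roots R")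
  case True
  then show ?thesis by (simp add: \<Lambda>_long_eq)
next
  case False
  then have short: "\<alpha> \<in> short_roots R" using assms short_iff by blast
  obtain \<gamma> where "\<gamma> \<in> long_roots R" using long_exists by blast
  with short_plus_long_\<Lambda>[OF short this _ zero_\<Lambda>] assms show ?thesis
    by (auto simp: \<Lambda>_long_eq)
qed

lemma \<Lambda>_long_subset_short: "\<Lambda>_long R \<Lambda> \<subseteq> \<Lambda>_short R \<Lambda>"
proof (cases "short_roots R = {}")
  case True
  then show ?thesis by (simp add: \<Lambda>_short_def)
next
  case False
  then obtain \<alpha> where "\<alpha> \<in> short_roots R" by blast
  then show ?thesis using \<Lambda>_long_subset \<Lambda>_short_eq short_in by auto
qed

text \<open>If a summand is long, or if both summands and the sum are short, some pairing is -1 and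
  \<open>\<Lambda>_pairing\<close> applies. Two short roots with a long sum are the only other case;
  there the sets have to coincide for the argument to work.\<close>

lemma \<Lambda>_add:
  assumes R: "\<alpha> \<in> R" "\<beta> \<in> R" "\<alpha> + \<beta> \<in> R" and yz: "y \<in> \<Lambda> \<alpha>" "z \<in> \<Lambda> \<beta>"
    and exception: "\<alpha> \<in> short_roots R \<Longrightarrow> \<beta> \<in> short_roots R \<Longrightarrow> \<alpha> + \<beta> \<in> long_roots R \<Longrightarrow>
      \<Lambda>_long R \<Lambda> = \<Lambda>_short R \<Lambda>"
  shows "y + z \<in> \<Lambda> (\<alpha> + \<beta>)"
proof -
  consider "\<alpha> \<in> long_roots R" | "\<beta> \<in> long_roots R"
    | "\<alpha> \<in> short_roots R" "\<beta> \<in> short_roots R" using R long_or_short by blast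
  then show ?thesis
  proof cases
    case 1
    with \<Lambda>_pairing[OF R(1,2) long_plus_root[OF 1 R(2,3)]] yz show ?thesis by auto
  next
    case 2
    have "\<beta> + \<alpha> \<in> R" using R by (simp add: add.commute)
    with \<Lambda>_pairing[OF R(2,1) long_plus_root[OF 2 R(1)]] yz show ?thesis
      by (metis add.commute)
  next
    case 3
    show ?thesis
    proof (cases "\<alpha> + \<beta> \<in> long_roots R")
      case True
      have "\<Lambda> \<alpha> = \<Lambda> (\<alpha> + \<beta>)" "\<Lambda> \<beta> = \<Lambda> (\<alpha> + \<beta>)"
        using exception[OF 3 True] 3 True by (metis \<Lambda>_long_eq \<Lambda>_short_eq)+
      then show ?thesis using short_plus_long_\<Lambda>[OF 3(2) True] yz by simp
    next
      case False
      then have "\<alpha> + \<beta> \<in> short_roots R" using R short_iff by blast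
      then have "\<beta> \<bullet> coroot \<alpha> = - 1"
        using norm_eq_plus_pairing[OF R(1) short_norm_eq[OF 3] short_norm_eq[OF _ 3(1)]] by blast
      with \<Lambda>_pairing[OF R(1,2)] yz show ?thesis by simp
    qed
  qed
qed

section \<open>Full preimages of closed subroot systems; the group of long translations\<close>

lemma affine_refl_real_roots:
  assumes "a \<in> real_roots R \<Lambda>" "b \<in> real_roots R \<Lambda>"
  shows "affine_refl a b \<in> real_roots R \<Lambda>"
  using assms refl_in refl_\<Lambda> by (cases a; cases b) (simp add: mem_real_roots affine_refl_def)

lemma real_roots_closed_subroot_system:
  assumes "closed_subroot_system root_refl R S"
  shows "closed_subroot_system affine_refl (real_roots R \<Lambda>) (real_roots S \<Lambda>)"
proof -
  have S: "S \<noteq> {}" "S \<subset> R" "\<And>a b. a \<in> S \<Longrightarrow> b \<in> S \<Longrightarrow> root_refl a b \<in> S"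
    "\<And>a b. a \<in> S \<Longrightarrow> b \<in> S \<Longrightarrow> a + b \<in> R \<Longrightarrow> a + b \<in> S"
    using assms
    by (auto simp: closed_subroot_system_def subroot_system_def closed_in_roots_def)
  have mem: "(\<alpha>, 0) \<in> real_roots T \<Lambda> \<longleftrightarrow> \<alpha> \<in> T" if "\<alpha> \<in> R" for \<alpha> T
    using zero_\<Lambda>[OF that] by (simp add: mem_real_roots)
  show ?thesis
    unfolding closed_subroot_system_def subroot_system_def closed_in_roots_def
  proof (intro conjI ballI impI)
    obtain \<alpha> where "\<alpha> \<in> S" using S by blast
    then show "real_roots S \<Lambda> \<noteq> {}" using mem[of \<alpha> S] S by blast
    obtain \<beta> where "\<beta> \<in> R" "\<beta> \<notin> S" using S by blast
    then have "(\<beta>, 0) \<in> real_roots R \<Lambda>" "(\<beta>, 0) \<notin> real_roots S \<Lambda>" using mem by auto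
    moreover have "real_roots S \<Lambda> \<subseteq> real_roots R \<Lambda>" using S by (auto simp: real_roots_def)
    ultimately show "real_roots S \<Lambda> \<subset> real_roots R \<Lambda>" by blast
  next
    fix a b assume "a \<in> real_roots S \<Lambda>" "b \<in> real_roots S \<Lambda>"
    moreover from this have "affine_refl a b \<in> real_roots R \<Lambda>"
      using S(2) by (intro affine_refl_real_roots) (auto simp: real_roots_def)
    ultimately show "affine_refl a b \<in> real_roots S \<Lambda>"
      using S(3) by (cases a; cases b) (auto simp: mem_real_roots affine_refl_def)
  next
    fix a b assume "a \<in> real_roots S \<Lambda>" "b \<in> real_roots S \<Lambda>" "a + b \<in> real_roots R \<Lambda>"
    then show "a + b \<in> real_roots S \<Lambda>"
      using S by (cases a; cases b) (auto simp: mem_real_roots)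
  qed
qed

lemma real_roots_split:
  assumes "S \<subseteq> R"
  shows "real_roots S \<Lambda> = (\<Union>\<alpha>\<in>S \<inter> short_roots R. {\<alpha>} \<times> \<Lambda>_short R \<Lambda>) \<union>
                (\<Union>\<alpha>\<in>S \<inter> long_roots R. {\<alpha>} \<times> \<Lambda>_long R \<Lambda>)"
proof -
  have "S = (S \<inter> short_roots R) \<union> (S \<inter> long_roots R)" using assms long_or_short by blast
  then have "real_roots S \<Lambda> = (\<Union>\<alpha>\<in>S \<inter> short_roots R. {\<alpha>} \<times> \<Lambda> \<alpha>) \<union>
      (\<Union>\<alpha>\<in>S \<inter> long_roots R. {\<alpha>} \<times> \<Lambda> \<alpha>)"
    unfolding real_roots_def by blast
  also have "\<dots> = (\<Union>\<alpha>\<in>S \<inter> short_roots R. {\<alpha>} \<times> \<Lambda>_short R \<Lambda>) \<union>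
      (\<Union>\<alpha>\<in>S \<inter> long_roots R. {\<alpha>} \<times> \<Lambda>_long R \<Lambda>)"
    by (intro arg_cong2[where f="(\<union>)"] SUP_cong) (simp_all flip: \<Lambda>_short_eq \<Lambda>_long_eq)
  finally show ?thesis .
qed

lemma gradient_real_roots:
  assumes "S \<subseteq> R"
  shows "gradient R \<Lambda> (real_roots S \<Lambda>) = S"
  using assms zero_\<Lambda> by (auto simp: gradient_def mem_real_roots)

text \<open>A root that is the sum of two long roots is as long as its summands by
  \<open>norm_long_plus\<close>. The existence of a short root makes the system proper.\<close>

lemma long_closed_subroot_system:
  assumes "short_roots R \<noteq> {}"
  shows "closed_subroot_system root_refl R (long_roots R)"
proof -
  have "long_roots R \<subset> R" using assms long_in short_in short_iff by blast
  moreover have "a + b \<in> long_roots R"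
    if "a \<in> long_roots R" "b \<in> long_roots R" "a + b \<in> R" for a b
    using norm_long_plus[OF that(1) long_in[OF that(2)] that(3)] that long_by_norm by metis
  ultimately show ?thesis
    using long_exists long_in long_refl
    by (auto simp: closed_subroot_system_def subroot_system_def closed_in_roots_def)
qed

text \<open>Outside type B2, maximality of the long roots yields two long roots that are neither
  orthogonal nor proportional. After a change of sign their pairing is -1, which makes the common
  value of \<Lambda> closed under addition.\<close>

lemma \<Lambda>_long_subgroup:
  assumes "maximal_closed_subroot_system root_refl R (long_roots R)" "short_roots R \<noteq> {}"
    and B2: "type_B2 R \<Longrightarrow> additive_subgroup (\<Lambda>_long R \<Lambda>)"
  shows "additive_subgroup (\<Lambda>_long R \<Lambda>)"
proof (cases "type_B2 R")
  case False
  then obtain a b where ab: "a \<in> long_roots R" "b \<in> long_roots R" "a \<bullet> b \<noteq> 0" "b \<noteq> a" "b \<noteq> - a"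
    using type_B2_if_orthogonal_long_roots assms(1,2) by blast
  then obtain b where b: "b \<in> long_roots R" "a \<bullet> b < 0" "b \<noteq> - a"
  proof (cases "a \<bullet> b < 0")
    case nonneg: False
    have "- b \<in> long_roots R" using ab uminus_long by blast
    then show thesis using that[of "- b"] ab nonneg by auto
  qed (use that in blast)
  have R: "a \<in> R" "b \<in> R" using ab b long_in by auto
  have "y + z \<in> \<Lambda> b" if "y \<in> \<Lambda> a" "z \<in> \<Lambda> b" for y z
    using \<Lambda>_pairing(2)[OF R pairing_long[OF ab(1) R(2) b(2,3)]] that by blast
  moreover have "\<Lambda>_long R \<Lambda> = \<Lambda> a" "\<Lambda>_long R \<Lambda> = \<Lambda> b" using ab b \<Lambda>_long_eq by auto
  ultimately show ?thesis
    using zero_\<Lambda>[OF R(1)] uminus_\<Lambda>[OF R(1)] by (auto simp: additive_subgroup_def)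
qed (rule B2)

section \<open>From a maximal system to its gradient\<close>

lemma maximal_gradient:
  assumes max: "maximal_closed_subroot_system affine_refl (real_roots R \<Lambda>) \<Psi>"
    and gr: "proper_closed_gradient R \<Lambda> \<Psi>"
  shows "\<Psi> = real_roots (gradient R \<Lambda> \<Psi>) \<Lambda>"
    and "maximal_closed_subroot_system root_refl R (gradient R \<Lambda> \<Psi>)"
proof -
  define S where "S = gradient R \<Lambda> \<Psi>"
  have \<Psi>: "\<Psi> \<noteq> {}" "\<Psi> \<subset> real_roots R \<Lambda>" "\<And>a b. a \<in> \<Psi> \<Longrightarrow> b \<in> \<Psi> \<Longrightarrow> affine_refl a b \<in> \<Psi>"
    using max by (auto simp: maximal_closed_subroot_system_def closed_subroot_system_def
        subroot_system_def)
  have S: "S = fst ` \<Psi>" using \<Psi> gradient_eq unfolding S_def by blast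
  have "root_refl a b \<in> S" if "a \<in> S" "b \<in> S" for a b
    using that \<Psi>(3) unfolding S by (force simp: affine_refl_def)
  moreover have "S \<noteq> {}" using S \<Psi> by blast
  ultimately have closed: "closed_subroot_system root_refl R S"
    using gr unfolding proper_closed_gradient_def closed_subroot_system_def subroot_system_def
    by (auto simp flip: S_def)
  have le: "\<Psi> \<subseteq> real_roots S \<Lambda>"
    using \<Psi>(2) by (force simp: S real_roots_def)
  \<comment> \<open>Taking \<open>T = S\<close> identifies \<Psi> as a full preimage. A larger
    \<open>T\<close> would have the same preimage, hence the same gradient, so \<open>S\<close> is
    maximal.\<close>
  have eqI: "\<Psi> = real_roots T \<Lambda>" if "closed_subroot_system root_refl R T" "S \<subseteq> T" for T
  proof -
    have "\<Psi> \<subseteq> real_roots T \<Lambda>" using le that(2) by (force simp: real_roots_def)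
    with real_roots_closed_subroot_system[OF that(1)] max show ?thesis
      unfolding maximal_closed_subroot_system_def closed_subroot_system_def subroot_system_def
      by blast
  qed
  show "\<Psi> = real_roots S \<Lambda>" using eqI closed by blast
  have "T = S" if "closed_subroot_system root_refl R T" "S \<subseteq> T" for T
    using eqI[OF that] gradient_real_roots[of T] that
    unfolding S_def closed_subroot_system_def subroot_system_def by auto
  then show "maximal_closed_subroot_system root_refl R S"
    using closed unfolding maximal_closed_subroot_system_def by blast
qed

lemma gradient_meets_short:
  assumes max: "maximal_closed_subroot_system affine_refl (real_roots R \<Lambda>) \<Psi>"
    and gr: "proper_closed_gradient R \<Lambda> \<Psi>"
    and B2: "type_B2 R \<Longrightarrow> additive_subgroup (\<Lambda>_long R \<Lambda>)"
    and less: "\<Lambda>_long R \<Lambda> \<subset> \<Lambda>_short R \<Lambda>"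
  shows "gradient R \<Lambda> \<Psi> \<inter> short_roots R \<noteq> {}"
proof
  define S where "S = gradient R \<Lambda> \<Psi>"
  assume "gradient R \<Lambda> \<Psi> \<inter> short_roots R = {}"
  moreover have S_max: "maximal_closed_subroot_system root_refl R S"
    using maximal_gradient[OF max gr] S_def by simp
  ultimately have "S \<subseteq> long_roots R"
    using long_or_short by (fastforce simp: S_def gradient_def)
  \<comment> \<open>Without short roots the convention makes the two sets equal.\<close>
  have short: "short_roots R \<noteq> {}" using less by (auto simp: \<Lambda>_short_def)
  have "S = long_roots R"
    using S_max long_closed_subroot_system[OF short] \<open>S \<subseteq> long_roots R\<close>
    unfolding maximal_closed_subroot_system_def closed_subroot_system_def subroot_system_def
    by blast
  define L where "L = \<Lambda>_long R \<Lambda>"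
  have L: "additive_subgroup L"
    using \<Lambda>_long_subgroup S_max short B2 unfolding \<open>S = long_roots R\<close> L_def by blast
  have \<Psi>: "\<Psi> = real_roots (long_roots R) \<Lambda>"
    using maximal_gradient(1)[OF max gr] \<open>S = long_roots R\<close> S_def by simp
  have "R \<times> L = \<Psi> \<or> R \<times> L = real_roots R \<Lambda>"
  proof (rule maximal_closed_subroot_systemD[OF max])
    show "\<Psi> \<subseteq> R \<times> L" using \<Lambda>_long_eq long_in by (auto simp: \<Psi> real_roots_def L_def)
    show "R \<times> L \<subseteq> real_roots R \<Lambda>" using \<Lambda>_long_subset by (auto simp: real_roots_def L_def)
    show "affine_refl a b \<in> R \<times> L" if "a \<in> R \<times> L" "b \<in> R \<times> L" for a b
    proof -
      have "(fst b \<bullet> coroot (fst a)) *\<^sub>R snd a \<in> L"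
        using that by (intro scaleR_int_subgroup[OF L] pairing_int) auto
      moreover have "snd b \<in> L" using that by auto
      ultimately have "snd b - (fst b \<bullet> coroot (fst a)) *\<^sub>R snd a \<in> L"
        using L unfolding additive_subgroup_def by (metis diff_conv_add_uminus)
      then show ?thesis using that refl_in by (auto simp: affine_refl_def)
    qed
    show "a + b \<in> R \<times> L" if "a \<in> R \<times> L" "b \<in> R \<times> L" "a + b \<in> real_roots R \<Lambda>" for a b
      using that L by (auto simp: additive_subgroup_def mem_real_roots)
  qed
  \<comment> \<open>A short root refutes both alternatives: over it, \<open>R \<times> L\<close>
    misses some real root, yet it contains the zero translate, which \<Psi> does not.\<close>
  moreover obtain \<alpha> where \<alpha>: "\<alpha> \<in> short_roots R" using short by blast
  moreover have "\<alpha> \<in> R" using \<alpha> short_in by blast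
  moreover obtain y where "y \<in> \<Lambda> \<alpha>" "y \<notin> L"
    using less \<Lambda>_short_eq[OF \<alpha>] unfolding L_def by blast
  then have "(\<alpha>, y) \<in> real_roots R \<Lambda>" "(\<alpha>, y) \<notin> R \<times> L"
    using \<open>\<alpha> \<in> R\<close> by (auto simp: mem_real_roots)
  moreover have "(\<alpha>, 0) \<in> R \<times> L" "(\<alpha>, 0) \<notin> \<Psi>"
    using L \<alpha> \<open>\<alpha> \<in> R\<close> short_iff by (auto simp: \<Psi> mem_real_roots additive_subgroup_def)
  ultimately show False by blast
qed

section \<open>Maximality of the full preimage of a maximal system\<close>

lemma real_roots_maximal:
  assumes max: "maximal_closed_subroot_system root_refl R S"
    and cond: "\<Lambda>_long R \<Lambda> = \<Lambda>_short R \<Lambda> \<or> S \<inter> short_roots R \<noteq> {}"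
    and \<Psi>: "closed_subroot_system affine_refl (real_roots R \<Lambda>) \<Psi>"
      "real_roots S \<Lambda> \<subseteq> \<Psi>"
  shows "\<Psi> = real_roots S \<Lambda>"
proof (rule ccontr)
  assume "\<Psi> \<noteq> real_roots S \<Lambda>"
  have S: "S \<noteq> {}" "S \<subset> R" "\<And>a b. a \<in> S \<Longrightarrow> b \<in> S \<Longrightarrow> root_refl a b \<in> S"
    "\<And>a b. a \<in> S \<Longrightarrow> b \<in> S \<Longrightarrow> a + b \<in> R \<Longrightarrow> a + b \<in> S"
    using max
    by (auto simp: maximal_closed_subroot_system_def closed_subroot_system_def
        subroot_system_def closed_in_roots_def)
  have \<Psi>_sub: "\<Psi> \<subset> real_roots R \<Lambda>"
    and \<Psi>_refl: "\<And>a b. a \<in> \<Psi> \<Longrightarrow> b \<in> \<Psi> \<Longrightarrow> affine_refl a b \<in> \<Psi>"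
    and \<Psi>_add: "\<And>a b. a \<in> \<Psi> \<Longrightarrow> b \<in> \<Psi> \<Longrightarrow> a + b \<in> real_roots R \<Lambda> \<Longrightarrow> a + b \<in> \<Psi>"
    using \<Psi>(1)
    by (auto simp: closed_subroot_system_def subroot_system_def closed_in_roots_def)
  define A where "A = {\<alpha>\<in>R. {\<alpha>} \<times> \<Lambda> \<alpha> \<subseteq> \<Psi>}"
  have A_D: "(\<alpha>, y) \<in> \<Psi>" if "\<alpha> \<in> A" "y \<in> \<Lambda> \<alpha>" for \<alpha> y
    using that by (auto simp: A_def)
  have "A = S \<or> A = R"
  proof (rule maximal_closed_subroot_systemD[OF max])
    show "S \<subseteq> A" using S(2) \<Psi>(2) by (auto simp: A_def real_roots_def)
    show "A \<subseteq> R" by (auto simp: A_def)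
    fix a b assume ab: "a \<in> A" "b \<in> A"
    then have R: "a \<in> R" "b \<in> R" by (auto simp: A_def)
    have "(root_refl a b, y) \<in> \<Psi>" if "y \<in> \<Lambda> (root_refl a b)" for y
    proof -
      have "affine_refl (a, 0) (b, y) \<in> \<Psi>"
        using that ab R by (intro \<Psi>_refl A_D zero_\<Lambda>) (auto simp: \<Lambda>_root_refl)
      then show ?thesis by (simp add: affine_refl_def)
    qed
    then show "root_refl a b \<in> A" using R refl_in by (auto simp: A_def)
    assume sum: "a + b \<in> R"
    \<comment> \<open>Any translation over \<open>a + b\<close> can thus be put entirely on one
      summand, with zero on the other. If the sum is short, one summand is short because the long
      roots are closed.\<close>
    have "\<Lambda> (a + b) \<subseteq> \<Lambda> a \<or> \<Lambda> (a + b) \<subseteq> \<Lambda> b"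
    proof (cases "a + b \<in> long_roots R")
      case True
      then show ?thesis using \<Lambda>_long_subset[OF R(1)] by (simp add: \<Lambda>_long_eq)
    next
      case False
      then have short: "a + b \<in> short_roots R" using sum short_iff by blast
      have "\<not> (a \<in> long_roots R \<and> b \<in> long_roots R)"
        using long_closed_subroot_system short short_iff[OF sum] sum
        by (auto simp: closed_subroot_system_def closed_in_roots_def)
      then have "a \<in> short_roots R \<or> b \<in> short_roots R" using R long_or_short by blast
      then show ?thesis using \<Lambda>_short_eq short by (metis order_refl)
    qed
    then have "(a + b, y) \<in> \<Psi>" if "y \<in> \<Lambda> (a + b)" for y
    proof
      assume "\<Lambda> (a + b) \<subseteq> \<Lambda> a"
      then have "(a, y) + (b, 0) \<in> \<Psi>"
        using that sum ab R by (intro \<Psi>_add A_D zero_\<Lambda>) (auto simp: mem_real_roots)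
      then show ?thesis by simp
    next
      assume "\<Lambda> (a + b) \<subseteq> \<Lambda> b"
      then have "(a, 0) + (b, y) \<in> \<Psi>"
        using that sum ab R by (intro \<Psi>_add A_D zero_\<Lambda>) (auto simp: mem_real_roots)
      then show ?thesis by simp
    qed
    then show "a + b \<in> A" using sum by (auto simp: A_def)
  qed
  moreover have "A \<noteq> R" using \<Psi>_sub A_D by (auto simp: real_roots_def)
  ultimately have "A = S" by blast
  define G where "G = fst ` \<Psi>"
  have G_R: "G \<subseteq> R" using \<Psi>_sub by (auto simp: G_def real_roots_def)
  have S_G: "S \<subseteq> G"
    using \<Psi>(2) S(2) zero_\<Lambda> by (force simp: G_def real_roots_def)
  have G_refl: "root_refl a b \<in> G" if "a \<in> G" "b \<in> G" for a b
    using that \<Psi>_refl by (force simp: G_def affine_refl_def)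
  define D where "D = G - S"
  have "D \<noteq> {}"
  proof
    assume "D = {}"
    then have "\<Psi> \<subseteq> real_roots S \<Lambda>"
      using \<Psi>_sub by (force simp: D_def G_def real_roots_def)
    with \<Psi>(2) \<open>\<Psi> \<noteq> real_roots S \<Lambda>\<close> show False by blast
  qed
  have D_R: "\<delta> \<in> R" if "\<delta> \<in> D" for \<delta> using that G_R by (auto simp: D_def)
  have uminus_S: "- \<gamma> \<in> S" if "\<gamma> \<in> S" for \<gamma>
    using S(3)[OF that that] root_nz that S(2) by (auto simp: root_refl_self)
  \<comment> \<open>\<open>S\<close> is stable under its own reflections and these are involutions,
    so they cannot move a root outside \<open>S\<close> into it.\<close>
  have D_refl: "root_refl \<gamma> \<delta> \<in> D" if "\<gamma> \<in> S" "\<delta> \<in> D" for \<gamma> \<delta>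
  proof -
    have "root_refl \<gamma> \<delta> \<notin> S"
      using S(3)[OF that(1)] that(2) by (metis D_def DiffD2 root_refl_involution)
    then show ?thesis using G_refl that S_G by (auto simp: D_def)
  qed
  have no_sum: "\<delta> \<in> short_roots R \<and> \<gamma> \<in> long_roots R \<and> \<Lambda>_long R \<Lambda> \<noteq> \<Lambda>_short R \<Lambda>"
    if \<delta>: "\<delta> \<in> D" and \<gamma>: "\<gamma> \<in> S" and sum: "\<delta> + \<gamma> \<in> R" for \<delta> \<gamma>
  proof (rule ccontr)
    assume neg: "\<not> ?thesis"
    have R: "\<delta> \<in> R" "\<gamma> \<in> R" using \<delta> \<gamma> D_R S by auto
    obtain z where z: "(\<delta>, z) \<in> \<Psi>" using \<delta> by (auto simp: D_def G_def)
    then have z_mem: "z \<in> \<Lambda> \<delta>" using \<Psi>_sub by (auto simp: mem_real_roots)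
    have "(\<delta> + \<gamma>, w) \<in> \<Psi>" if w: "w \<in> \<Lambda> (\<delta> + \<gamma>)" for w
    proof -
      \<comment> \<open>Writing \<gamma> as the sum of \<open>\<delta> + \<gamma>\<close> and
        \<open>- \<delta>\<close> shows that \<open>w - z\<close> lies over \<gamma>, where \<Psi>
        is full. The exceptional case of \<open>\<Lambda>_add\<close> is exactly the one that
        \<open>neg\<close> excludes.\<close>
      have "w + - z \<in> \<Lambda> (\<delta> + \<gamma> + - \<delta>)"
      proof (rule \<Lambda>_add[OF sum])
        show "- \<delta> \<in> R" using R uminus_root by blast
        show "- z \<in> \<Lambda> (- \<delta>)" using R z_mem uminus_\<Lambda> \<Lambda>_uminus_root by simp
        assume "- \<delta> \<in> short_roots R" "\<delta> + \<gamma> + - \<delta> \<in> long_roots R"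
        then show "\<Lambda>_long R \<Lambda> = \<Lambda>_short R \<Lambda>" using neg uminus_short by fastforce
      qed (use w R in auto)
      then have "(\<delta>, z) + (\<gamma>, w - z) \<in> \<Psi>"
        using w sum \<gamma> \<open>A = S\<close> by (intro \<Psi>_add[OF z] A_D) (auto simp: mem_real_roots)
      then show ?thesis by simp
    qed
    then have "\<delta> + \<gamma> \<in> S" using sum \<open>A = S\<close> by (auto simp: A_def)
    then have "\<delta> + \<gamma> + - \<gamma> \<in> S" 
      using S(4) uminus_S \<gamma> R by (metis add_diff_cancel_right' diff_conv_add_uminus)
    then show False using \<delta> by (simp add: D_def)
  qed
  \<comment> \<open>One of \<gamma> and \<open>- \<gamma>\<close> has negative inner product with
    \<delta>, so its sum with \<delta> is a root and \<open>no_sum\<close> applies.\<close>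
  have nonorth: "\<gamma> \<in> long_roots R \<and> \<Lambda>_long R \<Lambda> \<noteq> \<Lambda>_short R \<Lambda>"
    if \<delta>: "\<delta> \<in> D" and \<gamma>: "\<gamma> \<in> S" and "\<delta> \<bullet> \<gamma> \<noteq> 0" for \<delta> \<gamma>
  proof -
    have main: "c \<in> long_roots R \<and> \<Lambda>_long R \<Lambda> \<noteq> \<Lambda>_short R \<Lambda>"
      if c: "c \<in> S" "\<delta> \<bullet> c < 0" for c
    proof (rule no_sum[OF \<delta> c(1), THEN conjunct2])
      have "c \<noteq> - \<delta>" using uminus_S[OF c(1)] \<delta> by (auto simp: D_def)
      then show "\<delta> + c \<in> R" using root_sum c D_R[OF \<delta>] S(2) by blast
    qed
    show ?thesis
    proof (cases "\<delta> \<bullet> \<gamma> < 0")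
      case False
      then have "- \<gamma> \<in> long_roots R \<and> \<Lambda>_long R \<Lambda> \<noteq> \<Lambda>_short R \<Lambda>"
        using that by (intro main uminus_S) auto
      then show ?thesis using uminus_long by fastforce
    qed (use main \<gamma> in blast)
  qed
  have long_sum: "\<gamma> + \<alpha> \<notin> R" if "\<gamma> \<in> long_roots R" "\<alpha> \<in> R" "\<gamma> \<bullet> \<alpha> = 0" for \<gamma> \<alpha>
    using long_plus_root[OF that(1,2)] that(3) by (auto simp: inner_coroot inner_commute)
  define M where "M = {\<gamma>\<in>S. \<forall>\<delta>\<in>D. \<delta> \<bullet> \<gamma> = 0}"
  have M_S: "M \<subseteq> S" by (auto simp: M_def)
  then have M_R: "M \<subseteq> R" using S by blast
  have "M \<noteq> {}"
  proof (cases "\<Lambda>_long R \<Lambda> = \<Lambda>_short R \<Lambda>")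
    case True
    then have "M = S" using nonorth unfolding M_def by blast
    then show ?thesis using S(1) by simp
  next
    case False
    then obtain p where "p \<in> S" "p \<in> short_roots R" using cond by blast
    \<comment> \<open>By \<open>nonorth\<close> only long roots of \<open>S\<close> can fail to be
      orthogonal to \<open>D\<close>. This is where the short root supplied by \<open>cond\<close>
      enters.\<close>
    then have "p \<in> M" using nonorth short_iff[of p] short_in by (auto simp: M_def)
    then show ?thesis by blast
  qed
  \<comment> \<open>Strong orthogonality is required: orthogonal short roots may still add up to a
    root, and then \<open>M \<union> T\<close> need not be closed.\<close>
  define T where "T = {\<alpha>\<in>R. \<forall>m\<in>M. m \<bullet> \<alpha> = 0 \<and> m + \<alpha> \<notin> R}"
  have uminus_M: "- m \<in> M" if "m \<in> M" for m using that uminus_S by (auto simp: M_def)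
  have D_T: "D \<subseteq> T"
  proof
    fix \<delta> assume \<delta>: "\<delta> \<in> D"
    have "m \<bullet> \<delta> = 0 \<and> m + \<delta> \<notin> R" if m: "m \<in> M" for m
    proof
      show 0: "m \<bullet> \<delta> = 0" using m \<delta> by (auto simp: M_def inner_commute)
      \<comment> \<open>If the sum were a root, \<open>no_sum\<close> would make \<open>m\<close>
        long, and \<open>long_sum\<close> forbids this for orthogonal roots.\<close>
      show "m + \<delta> \<notin> R"
        using no_sum[OF \<delta>, of m] long_sum[OF _ D_R[OF \<delta>] 0] m M_S by (auto simp: add.commute)
    qed
    then show "\<delta> \<in> T" using D_R[OF \<delta>] by (auto simp: T_def)
  qed
  have N_T: "S - M \<subseteq> T"
  proof
    fix \<gamma> assume "\<gamma> \<in> S - M"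
    then obtain \<delta> where \<gamma>: "\<gamma> \<in> S" and \<delta>: "\<delta> \<in> D" "\<delta> \<bullet> \<gamma> \<noteq> 0" by (auto simp: M_def)
    have \<gamma>R: "\<gamma> \<in> R" using \<gamma> S by blast
    have "m \<bullet> \<gamma> = 0 \<and> m + \<gamma> \<notin> R" if m: "m \<in> M" for m
    proof
      \<comment> \<open>Both \<delta> and its reflection in \<gamma> lie in \<open>D\<close>, and
        they differ by a non-zero multiple of \<gamma>; so \<open>m\<close> is orthogonal to
        \<gamma>.\<close>
      have "m \<bullet> \<delta> = 0" "m \<bullet> root_refl \<gamma> \<delta> = 0"
        using m \<delta>(1) D_refl[OF \<gamma> \<delta>(1)] by (auto simp: M_def inner_commute)
      then have "(\<delta> \<bullet> coroot \<gamma>) * (m \<bullet> \<gamma>) = 0" by (simp add: inner_root_refl)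
      moreover have "\<delta> \<bullet> coroot \<gamma> \<noteq> 0" using \<delta> \<gamma>R root_nz by (simp add: inner_coroot)
      ultimately show 0: "m \<bullet> \<gamma> = 0" by simp
      show "m + \<gamma> \<notin> R"
        using long_sum[of \<gamma> m] nonorth[OF \<delta>(1) \<gamma> \<delta>(2)] 0 m M_R
        by (auto simp: add.commute inner_commute)
    qed
    then show "\<gamma> \<in> T" using \<gamma>R by (auto simp: T_def)
  qed
  have "M \<union> T = S \<or> M \<union> T = R"
  proof (rule maximal_closed_subroot_systemD[OF max])
    show "S \<subseteq> M \<union> T" using N_T by blast
    show "M \<union> T \<subseteq> R" using M_R by (auto simp: T_def)
    have MT: "m \<bullet> t = 0" "t \<bullet> m = 0" "m + t \<notin> R" "t + m \<notin> R" if "m \<in> M" "t \<in> T" for m t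
      using that by (auto simp: T_def inner_commute add.commute)
    fix a b assume ab: "a \<in> M \<union> T" "b \<in> M \<union> T"
    have MM: "root_refl a b \<in> M" if "a \<in> M" "b \<in> M"
      using that S(3) by (auto simp: M_def inner_root_refl)
    have TT: "root_refl a b \<in> T" if "a \<in> T" "b \<in> T"
    proof -
      have R: "a \<in> R" "b \<in> R" using that by (auto simp: T_def)
      have "m \<bullet> root_refl a b = 0 \<and> m + root_refl a b \<notin> R" if m: "m \<in> M" for m
      proof
        have a: "m \<bullet> a = 0" "m \<bullet> b = 0" using MT m \<open>a \<in> T\<close> \<open>b \<in> T\<close> by auto
        then show "m \<bullet> root_refl a b = 0" by (simp add: inner_root_refl)
        \<comment> \<open>The reflection in \<open>a\<close> fixes \<open>m\<close>, so it exchanges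
          \<open>m + b\<close> with \<open>m + root_refl a b\<close>, and neither is a root.\<close>
        have "root_refl a (m + b) = m + root_refl a b"
          using a by (simp add: root_refl_plus root_refl_orthogonal)
        then have "root_refl a (m + root_refl a b) = m + b" by (metis root_refl_involution)
        then show "m + root_refl a b \<notin> R"
          using refl_in[OF R(1)] MT(3)[OF m \<open>b \<in> T\<close>] by metis
      qed
      then show ?thesis using R refl_in by (auto simp: T_def)
    qed
    show "root_refl a b \<in> M \<union> T"
      using ab MM TT MT(1,2) root_refl_orthogonal by (metis UnE UnI1 UnI2)
    assume sum: "a + b \<in> R"
    have "a + b \<in> M" if "a \<in> M" "b \<in> M"
      using that sum S(4) by (auto simp: M_def inner_add_right)
    moreover have "a + b \<in> T" if "a \<in> T" "b \<in> T"
    proof -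
      have R: "a \<in> R" "b \<in> R" using that by (auto simp: T_def)
      have "m + (a + b) \<notin> R" if m: "m \<in> M" for m
      proof
        assume mab: "m + (a + b) \<in> R"
        have orth: "m \<bullet> a = 0" "m \<bullet> b = 0" using MT m \<open>a \<in> T\<close> \<open>b \<in> T\<close> by auto
        \<comment> \<open>Otherwise \<open>root_sum\<close> allows \<open>c\<close> to be subtracted
          from the root \<open>m + (a + b)\<close>, leaving \<open>m\<close> plus the other summand,
          which is not a root. Both inner products cannot fail to be positive, since they add up to
          the squared length of \<open>a + b\<close>.\<close>
        have *: "\<not> (a + b) \<bullet> c > 0"
          if c: "c \<in> {a, b}" for c
        proof
          assume pos: "(a + b) \<bullet> c > 0"
          define d where "d = a + b - c"
          have cd: "c \<in> R" "d \<in> T" "m \<bullet> c = 0" "m \<bullet> d = 0"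
            using c R orth \<open>a \<in> T\<close> \<open>b \<in> T\<close> by (auto simp: d_def)
          have "m + (a + b) + - c \<in> R"
          proof (rule root_sum[OF mab])
            show "- c \<in> R" using cd uminus_root by blast
            show "(m + (a + b)) \<bullet> - c < 0" using pos cd by (simp add: inner_add_left)
            show "- c \<noteq> - (m + (a + b))"
            proof
              assume "- c = - (m + (a + b))"
              then have "m + d = 0" by (simp add: d_def algebra_simps)
              then have "m \<bullet> (m + d) = 0" by simp
              then have "m \<bullet> m = 0" using cd by (simp add: inner_add_right)
              then show False using m M_R root_nz by auto
            qed
          qed
          then have "m + d \<in> R" by (simp add: d_def algebra_simps)
          then show False using MT(3)[OF m cd(2)] by blast
        qed
        have "(a + b) \<bullet> a + (a + b) \<bullet> b > 0"
          using root_inner_pos[OF sum] by (simp only: inner_add_right)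
        with *[of a] *[of b] show False by auto
      qed
      moreover have "m \<bullet> (a + b) = 0" if "m \<in> M" for m
        using MT(1)[OF that] \<open>a \<in> T\<close> \<open>b \<in> T\<close> by (simp add: inner_add_right)
      ultimately show ?thesis using sum unfolding T_def by blast
    qed
    ultimately show "a + b \<in> M \<union> T" using ab sum MT(3,4) by blast
  qed
  moreover have "M \<union> T \<noteq> S" using \<open>D \<noteq> {}\<close> D_T by (auto simp: D_def)
  ultimately have R_eq: "R = M \<union> T" by blast
  have "T \<noteq> {}" using \<open>D \<noteq> {}\<close> D_T by blast
  have "m \<bullet> t = 0" if "m \<in> M" "t \<in> T" for m t using that unfolding T_def by blast
  then show False by (rule not_decomposable[OF \<open>M \<noteq> {}\<close> \<open>T \<noteq> {}\<close> R_eq])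
qed

end

theorem theorem8:
  fixes R :: "'v::euclidean_space set"
    and Y :: "'y::real_vector set"
    and \<Lambda> :: "'v \<Rightarrow> 'y set"
    and \<Psi> :: "('v \<times> 'y) set"
  assumes "finite_root_system R" and "reduced_roots R" and "irreducible_roots R"
    and "DIM('v) \<ge> 2"
    and "extension_datum R Y \<Lambda>"
    and "type_B2 R \<Longrightarrow> additive_subgroup (\<Lambda>_long R \<Lambda>)"
    and "\<Psi> \<subseteq> affine_roots R \<Lambda>"
  shows "maximal_closed_subroot_system affine_refl (real_roots R \<Lambda>) \<Psi> \<and>
           proper_closed_gradient R \<Lambda> \<Psi>
         \<longleftrightarrow>
         (\<exists>R'. maximal_closed_subroot_system root_refl R R' \<and>
            (\<Lambda>_long R \<Lambda> = \<Lambda>_short R \<Lambda> \<or>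
             (\<Lambda>_long R \<Lambda> \<subset> \<Lambda>_short R \<Lambda> \<and> R' \<inter> short_roots R \<noteq> {})) \<and>
            \<Psi> = (\<Union>\<alpha>\<in>R' \<inter> short_roots R. {\<alpha>} \<times> \<Lambda>_short R \<Lambda>) \<union>
                (\<Union>\<alpha>\<in>R' \<inter> long_roots R. {\<alpha>} \<times> \<Lambda>_long R \<Lambda>))"
proof -
  interpret root_extension R Y \<Lambda>
    using assms by unfold_locales
  show ?thesis
  proof
    assume "maximal_closed_subroot_system affine_refl (real_roots R \<Lambda>) \<Psi> \<and>
      proper_closed_gradient R \<Lambda> \<Psi>"
    then have max: "maximal_closed_subroot_system affine_refl (real_roots R \<Lambda>) \<Psi>"
      and gr: "proper_closed_gradient R \<Lambda> \<Psi>" by auto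
    have "gradient R \<Lambda> \<Psi> \<subseteq> R" by (auto simp: gradient_def)
    then have "\<Psi> = (\<Union>\<alpha>\<in>gradient R \<Lambda> \<Psi> \<inter> short_roots R. {\<alpha>} \<times> \<Lambda>_short R \<Lambda>) \<union>
        (\<Union>\<alpha>\<in>gradient R \<Lambda> \<Psi> \<inter> long_roots R. {\<alpha>} \<times> \<Lambda>_long R \<Lambda>)"
      using maximal_gradient(1)[OF max gr] real_roots_split by simp
    \<comment> \<open>The inclusion of the long set in the short one always holds, so equality and
      strict inclusion exhaust the cases.\<close>
    moreover have "\<Lambda>_long R \<Lambda> = \<Lambda>_short R \<Lambda> \<or>
        (\<Lambda>_long R \<Lambda> \<subset> \<Lambda>_short R \<Lambda> \<and> gradient R \<Lambda> \<Psi> \<inter> short_roots R \<noteq> {})"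
      using gradient_meets_short[OF max gr assms(6)] \<Lambda>_long_subset_short by blast
    ultimately show "\<exists>R'. maximal_closed_subroot_system root_refl R R' \<and>
            (\<Lambda>_long R \<Lambda> = \<Lambda>_short R \<Lambda> \<or>
             (\<Lambda>_long R \<Lambda> \<subset> \<Lambda>_short R \<Lambda> \<and> R' \<inter> short_roots R \<noteq> {})) \<and>
            \<Psi> = (\<Union>\<alpha>\<in>R' \<inter> short_roots R. {\<alpha>} \<times> \<Lambda>_short R \<Lambda>) \<union>
                (\<Union>\<alpha>\<in>R' \<inter> long_roots R. {\<alpha>} \<times> \<Lambda>_long R \<Lambda>)"
      using maximal_gradient(2)[OF max gr] by blast
  next
    assume "\<exists>R'. maximal_closed_subroot_system root_refl R R' \<and>
            (\<Lambda>_long R \<Lambda> = \<Lambda>_short R \<Lambda> \<or>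
             (\<Lambda>_long R \<Lambda> \<subset> \<Lambda>_short R \<Lambda> \<and> R' \<inter> short_roots R \<noteq> {})) \<and>
            \<Psi> = (\<Union>\<alpha>\<in>R' \<inter> short_roots R. {\<alpha>} \<times> \<Lambda>_short R \<Lambda>) \<union>
                (\<Union>\<alpha>\<in>R' \<inter> long_roots R. {\<alpha>} \<times> \<Lambda>_long R \<Lambda>)"
    then obtain S where max: "maximal_closed_subroot_system root_refl R S"
      and cond: "\<Lambda>_long R \<Lambda> = \<Lambda>_short R \<Lambda> \<or> S \<inter> short_roots R \<noteq> {}"
      and \<Psi>: "\<Psi> = (\<Union>\<alpha>\<in>S \<inter> short_roots R. {\<alpha>} \<times> \<Lambda>_short R \<Lambda>) \<union>
                (\<Union>\<alpha>\<in>S \<inter> long_roots R. {\<alpha>} \<times> \<Lambda>_long R \<Lambda>)"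
      by blast
    have closed: "closed_subroot_system root_refl R S"
      using max by (simp add: maximal_closed_subroot_system_def)
    then have "S \<subset> R" "closed_in_roots R S"
      by (auto simp: closed_subroot_system_def subroot_system_def)
    then have "\<Psi> = real_roots S \<Lambda>" using \<Psi> real_roots_split[of S] by simp
    moreover have "proper_closed_gradient R \<Lambda> (real_roots S \<Lambda>)"
      using \<open>S \<subset> R\<close> \<open>closed_in_roots R S\<close> gradient_real_roots[of S]
      by (simp add: proper_closed_gradient_def)
    moreover have "maximal_closed_subroot_system affine_refl (real_roots R \<Lambda>) (real_roots S \<Lambda>)"
      unfolding maximal_closed_subroot_system_def
      using real_roots_closed_subroot_system[OF closed] real_roots_maximal[OF max cond] by blast
    ultimately show "maximal_closed_subroot_system affine_refl (real_roots R \<Lambda>) \<Psi> \<and>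
      proper_closed_gradient R \<Lambda> \<Psi>" by simp
  qed
qed

end
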